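(* $\mathrm{Fair\text{-}S}(n-1,1)\subseteq \mathrm{P/poly}$.
   Context: Sets are languages over $\Sigma=\{0,1\}$; FP is the class of polynomial-time computable functions. $\mathrm{Fair\text{-}S}(n-1,1)$ is the class of sets $L$ for which there is an FP function $f$ such that for every $n\geq 1$ and all distinct strings $y_1,\dots,y_n$ each of length at most $n$ (given as a tuple in lexicographic order): $f(y_1,\dots,y_n)\subseteq\{y_1,\dots,y_n\}$, and if $\|L\cap\{y_1,\dots,y_n\}\|\geq n-1$ then $f(y_1,\dots,y_n)\subseteq L$ and $\|f(y_1,\dots,y_n)\|\geq 1$. $\mathrm{P/poly}$ is the class of sets $L$ for which there exist $A\in\mathrm{P}$ and a polynomially length-bounded function $h$ such that for all $x$, $x\in L\iff\langle x,h(0^{|x|})\rangle\in A$. *)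

theory Defs
  imports Main "HOL-Computational_Algebra.Polynomial"
begin

section \<open>Strings, languages and encodings\<close>

text \<open>The letters 0 and 1 are \<open>False\<close> and \<open>True\<close>.\<close>

type_synonym str = "bool list"
type_synonym lang = "str set"

text \<open>A self-delimiting encoding: every letter is preceded by a 1, and every component of the
  tuple is closed by a 0.\<close>

definition encode_item :: "str \<Rightarrow> str" where
  "encode_item y = concat (map (\<lambda>b. [True, b]) y) @ [False]"

definition encode_tuple :: "str list \<Rightarrow> str" where
  "encode_tuple ys = concat (map encode_item ys)"

definition encode_pair :: "str \<Rightarrow> str \<Rightarrow> str" where
  "encode_pair x y = encode_tuple [x, y]"

lemma encode_item_append_inject:
  "encode_item x @ u = encode_item y @ v \<longleftrightarrow> x = y \<and> u = v"
proof (induction x arbitrary: y)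
  case Nil
  then show ?case by (cases y) (auto simp: encode_item_def)
next
  case (Cons a x)
  then show ?case by (cases y) (auto simp: encode_item_def)
qed

lemma encode_tuple_inject: "encode_tuple xs = encode_tuple ys \<longleftrightarrow> xs = ys"
proof (induction xs arbitrary: ys)
  case Nil
  then show ?case by (cases ys) (auto simp: encode_tuple_def encode_item_def)
next
  case (Cons a xs)
  then show ?case
  proof (cases ys)
    case Nil
    then show ?thesis by (auto simp: encode_tuple_def encode_item_def)
  next
    case (Cons b zs)
    then show ?thesis
      using Cons.IH[of zs] by (auto simp: encode_tuple_def encode_item_append_inject)
  qed
qed

section \<open>Deterministic multi-tape Turing machines\<close>

text \<open>Symbols are natural numbers: 0 is the blank, 1 and 2 are the letters 0 and 1, and larger
  numbers are further work symbols. Tapes are infinite in both directions.\<close>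

type_synonym symbol = nat

datatype dir = Go_Left | Stay | Go_Right

record tm =
  num_tapes :: nat
  num_symbols :: nat
  num_states :: nat
  trans :: "nat \<Rightarrow> symbol list \<Rightarrow> nat \<times> (symbol \<times> dir) list"

text \<open>The states are \<open>0, \<dots>, num_states M\<close>; 0 is the start state and \<open>num_states M\<close> the halting
  state. Tape 0 is the input tape and tape 1 the output tape; both may also be used as work tapes.
  Only the finitely many values of \<open>trans M\<close> constrained here are ever consulted.\<close>

definition wf_tm :: "tm \<Rightarrow> bool" where
  "wf_tm M \<longleftrightarrow> num_tapes M \<ge> 2 \<and> num_symbols M \<ge> 3 \<and>
     (\<forall>q < num_states M. \<forall>rs. length rs = num_tapes M \<and> (\<forall>s \<in> set rs. s < num_symbols M) \<longrightarrow>
        fst (trans M q rs) \<le> num_states M \<and>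
        length (snd (trans M q rs)) = num_tapes M \<and>
        (\<forall>(s, d) \<in> set (snd (trans M q rs)). s < num_symbols M))"

type_synonym tape = "(int \<Rightarrow> symbol) \<times> int"
type_synonym config = "nat \<times> tape list"

fun scanned :: "tape \<Rightarrow> symbol" where
  "scanned (c, h) = c h"

fun act :: "symbol \<times> dir \<Rightarrow> tape \<Rightarrow> tape" where
  "act (s, d) (c, h) = (c(h := s), case d of Go_Left \<Rightarrow> h - 1 | Stay \<Rightarrow> h | Go_Right \<Rightarrow> h + 1)"

fun step :: "tm \<Rightarrow> config \<Rightarrow> config" where
  "step M (q, ts) =
     (if q < num_states M
      then (let (q', as) = trans M q (map scanned ts) in (q', map2 act as ts))
      else (q, ts))"

definition str_contents :: "str \<Rightarrow> int \<Rightarrow> symbol" where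
  "str_contents x i =
     (if 0 \<le> i \<and> i < int (length x) then (if x ! nat i then 2 else 1) else 0)"

definition init_config :: "tm \<Rightarrow> str \<Rightarrow> config" where
  "init_config M x =
     (0, (str_contents x, 0) # replicate (num_tapes M - 1) (str_contents [], 0))"

definition computes_within :: "tm \<Rightarrow> str \<Rightarrow> str \<Rightarrow> nat \<Rightarrow> bool" where
  "computes_within M x y T \<longleftrightarrow>
     (\<exists>t \<le> T. \<exists>ts. (step M ^^ t) (init_config M x) = (num_states M, ts) \<and>
        fst (ts ! 1) = str_contents y)"

section \<open>Complexity classes\<close>

definition FP :: "(str \<Rightarrow> str) set" where
  "FP = {f. \<exists>M. wf_tm M \<and> (\<exists>p :: nat poly. \<forall>x. computes_within M x (f x) (poly p (length x)))}"

definition P :: "lang set" where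
  "P = {A. (\<lambda>x. [x \<in> A]) \<in> FP}"

definition poly_length_bounded :: "(str \<Rightarrow> str) \<Rightarrow> bool" where
  "poly_length_bounded h \<longleftrightarrow> (\<exists>p :: nat poly. \<forall>z. length (h z) \<le> poly p (length z))"

definition P_poly :: "lang set" where
  "P_poly = {L. \<exists>A \<in> P. \<exists>h. poly_length_bounded h \<and>
     (\<forall>x. x \<in> L \<longleftrightarrow> encode_pair x (h (replicate (length x) False)) \<in> A)}"

definition lex_less :: "str \<Rightarrow> str \<Rightarrow> bool" where
  "lex_less u v \<longleftrightarrow> (u, v) \<in> lexord {(False, True)}"

text \<open>\<open>Fair_S b c\<close> is Fair-S(b(n), c(n)). The selector is a function on strings; the finite set that
  it outputs is given by a tuple \<open>zs\<close> listing the elements of the set in any order.\<close>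

definition Fair_S :: "(nat \<Rightarrow> nat) \<Rightarrow> (nat \<Rightarrow> nat) \<Rightarrow> lang set" where
  "Fair_S b c = {L. \<exists>f \<in> FP. \<forall>n \<ge> 1. \<forall>ys.
     length ys = n \<and> distinct ys \<and> sorted_wrt lex_less ys \<and> (\<forall>y \<in> set ys. length y \<le> n) \<longrightarrow>
     (\<exists>zs. f (encode_tuple ys) = encode_tuple zs \<and> set zs \<subseteq> set ys \<and>
        (card (L \<inter> set ys) \<ge> b n \<longrightarrow> set zs \<subseteq> L \<and> card (set zs) \<ge> c n))}"

end

theory Submission
  imports Defs
begin

text \<open>Fix a length \<open>m \<ge> 1\<close>, let \<open>n = m\<close> and let \<open>C\<close> be the set of strings of length \<open>m\<close> in \<open>L\<close>. If
  \<open>S \<subseteq> C\<close> has \<open>n - 1\<close> elements and \<open>x \<notin> S\<close>, then the selector applied to \<open>S \<union> {x}\<close> returns a nonempty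
  subset of \<open>L\<close>, so \<open>x\<close> being selected certifies \<open>x \<in> L\<close>. Counting the \<open>n\<close>-subsets of \<open>C\<close> by
  one selected element shows that some \<open>S\<close> together with the elements that it certifies makes up at
  least a fraction \<open>1/n\<close> of \<open>C\<close>; removing these and repeating, polynomially many sets \<open>S\<close> cover \<open>C\<close>.

  To decide \<open>L\<close> from such advice with a Turing machine, the advice is not the list of the sets \<open>S\<close>
  but an unrolled straight-line program that performs all the queries. The decider spends one
  step on every input symbol, so it trivially runs in linear time on all inputs, and all loops
  (simulating the selector for its time bound, finding and scanning its output, erasing its tapes)
  live in the advice. As the position of \<open>x\<close> among the elements of \<open>S\<close> is not known in advance, every
  position is tried, and the answer is used only if \<open>x\<close> was found to fit there.\<close>

section \<open>Head-centred tapes\<close>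

text \<open>Tapes are viewed relative to the head, so that a configuration does not depend on where on
  the tape a computation takes place.\<close>

type_synonym ctape = "int \<Rightarrow> symbol"

fun dir_offset :: "dir \<Rightarrow> int" where
  "dir_offset Go_Left = -1"
| "dir_offset Stay = 0"
| "dir_offset Go_Right = 1"

fun cact :: "symbol \<times> dir \<Rightarrow> ctape \<Rightarrow> ctape" where
  "cact (s, d) g = (\<lambda>i. (g(0 := s)) (i + dir_offset d))"

fun centre :: "tape \<Rightarrow> ctape" where
  "centre (c, h) = (\<lambda>i. c (i + h))"

definition cstep :: "tm \<Rightarrow> nat \<times> ctape list \<Rightarrow> nat \<times> ctape list" where
  "cstep M = (\<lambda>(q, gs).
     if q < num_states M
     then (let (q', as) = trans M q (map (\<lambda>g. g 0) gs) in (q', map2 cact as gs))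
     else (q, gs))"

lemma centre_0 [simp]: "centre t 0 = scanned t"
  by (cases t) auto

lemma centre_act: "centre (act a t) = cact a (centre t)"
proof (cases t; cases a)
  fix c h s d
  assume "t = (c, h)" "a = (s, d)"
  then show ?thesis by (cases d) (auto simp: fun_eq_iff algebra_simps)
qed

lemma map_centre_act: "map centre (map2 act as ts) = map2 cact as (map centre ts)"
proof (induction as arbitrary: ts)
  case (Cons a as)
  then show ?case by (cases ts) (auto simp: centre_act simp del: cact.simps centre.simps)
qed simp

lemma cstep_centre: "cstep M (q, map centre ts) = map_prod id (map centre) (step M (q, ts))"
proof -
  have "map (\<lambda>g. g 0) (map centre ts) = map scanned ts"
    by simp
  then show ?thesis
    by (cases "trans M q (map scanned ts)") (simp add: cstep_def map_centre_act del: map_map)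
qed

lemma cstep_funpow_centre:
  "(cstep M ^^ t) (q, map centre ts) = map_prod id (map centre) ((step M ^^ t) (q, ts))"
proof (induction t)
  case (Suc t)
  obtain q' ts' where "(step M ^^ t) (q, ts) = (q', ts')"
    by (cases "(step M ^^ t) (q, ts)")
  with Suc show ?case by (simp add: cstep_centre id_def del: step.simps)
qed simp

lemma cact_keep: "cact (g 0, Stay) g = g"
  by auto

definition keep :: "symbol list \<Rightarrow> (symbol \<times> dir) list" where
  "keep = map (\<lambda>s. (s, Stay))"

lemma keep_simps [simp]: "keep [] = []" "keep (s # ss) = (s, Stay) # keep ss"
  "length (keep ss) = length ss"
  by (auto simp: keep_def)

lemma map2_cact_keep: "map2 cact (keep (map (\<lambda>g. g 0) gs)) gs = gs"
  by (induction gs) (auto simp: cact_keep simp del: cact.simps)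

definition shift :: "int \<Rightarrow> ctape \<Rightarrow> ctape" where
  "shift d g = (\<lambda>i. g (i + d))"

lemma shift_shift [simp]: "shift d (shift e g) = shift (d + e) g"
  by (simp add: shift_def add.assoc)

lemma shift_0 [simp]: "shift 0 g = g"
  by (simp add: shift_def)

lemma shift_at_0 [simp]: "shift d g 0 = g d"
  by (simp add: shift_def)

lemma cact_move [simp]:
  "cact (g 0, Go_Left) g = shift (-1) g" "cact (g 0, Go_Right) g = shift 1 g"
  by (auto simp: shift_def)

lemma str_contents_Nil [simp]: "str_contents [] = (\<lambda>_. 0)"
  by (auto simp: str_contents_def)

abbreviation sym :: "bool \<Rightarrow> symbol" where
  "sym b \<equiv> (if b then 2 else 1)"

text \<open>With the head just behind a word, writing a letter and moving right appends it. This is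
  the invariant both for storing \<open>x\<close> and for writing the selector's input.\<close>

lemma cact_str_contents:
  "cact (sym b, Go_Right) (shift (int (length x)) (str_contents x)) =
   shift (int (length (x @ [b]))) (str_contents (x @ [b]))"
  by (auto simp: fun_eq_iff shift_def str_contents_def nth_append nat_add_distrib add.assoc)

section \<open>Deciders that execute their advice\<close>

definition exec :: "('i \<Rightarrow> symbol list \<Rightarrow> (symbol \<times> dir) list) \<Rightarrow> 'i \<Rightarrow> ctape list \<Rightarrow> ctape list"
  where "exec \<delta> i gs = map2 cact (\<delta> i (map (\<lambda>g. g 0) gs)) gs"

text \<open>These are the tapes once \<open>x\<close> has been read: the head on \<open>x\<close>
  still stands behind the last letter, which is why programs begin by returning it.\<close>

definition init_tapes :: "nat \<Rightarrow> str \<Rightarrow> ctape list" where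
  "init_tapes K x = (\<lambda>_. 0) # shift (int (length x)) (str_contents x) # replicate (K - 2) (\<lambda>_. 0)"

text \<open>The control register \<open>p\<close> parses \<open>encode_pair x a\<close>: the values 0 and 1 mean that the marker or
  the letter of a position of \<open>x\<close> is expected, \<open>2 + 2 * j\<close> and \<open>3 + 2 * j\<close> the same for \<open>a\<close>
  after \<open>j\<close> letters 1. A letter 0 of \<open>a\<close> then triggers the instruction number \<open>j\<close>.\<close>

definition control ::
  "nat \<Rightarrow> nat \<Rightarrow> (nat \<Rightarrow> symbol list \<Rightarrow> (symbol \<times> dir) list) \<Rightarrow> symbol \<Rightarrow> nat \<Rightarrow> symbol list \<Rightarrow>
     nat \<times> (symbol \<times> dir) list" where
  "control N D \<delta> b p ss =
     (if p = 0 then (if b = 2 then 1 else 2, keep ss)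
      else if p = 1 then (0, (hd ss, Stay) # (b, Go_Right) # keep (tl (tl ss)))
      else if even p then (if b = 2 then min (p + 1) (N - 1) else 2, keep ss)
      else if b = 2 then (min (p + 1) (N - 1), keep ss)
      else (2, if (p - 3) div 2 < D then \<delta> ((p - 3) div 2) ss else keep ss))"

definition stream_step ::
  "nat \<Rightarrow> nat \<Rightarrow> (nat \<Rightarrow> symbol list \<Rightarrow> (symbol \<times> dir) list) \<Rightarrow> bool \<Rightarrow> nat \<times> ctape list \<Rightarrow>
     nat \<times> ctape list" where
  "stream_step N D \<delta> b = (\<lambda>(p, gs). let (p', as) = control N D \<delta> (sym b) p (map (\<lambda>g. g 0) gs)
     in (p', map2 cact as gs))"

text \<open>The first of the \<open>K\<close> program tapes is the output tape; the control register
  is a symbol on tape 2, so that one working state suffices. At the first nonletter the acceptance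
  flag is turned into the answer and the machine halts.\<close>

definition stream_tm ::
  "nat \<Rightarrow> nat \<Rightarrow> nat \<Rightarrow> (nat \<Rightarrow> symbol list \<Rightarrow> (symbol \<times> dir) list) \<Rightarrow> tm" where
  "stream_tm K N D \<delta> = \<lparr>num_tapes = K + 2, num_symbols = N, num_states = 1,
     trans = (\<lambda>q rs.
       let b = rs ! 0; s = rs ! 1; p = rs ! 2; ss = drop 3 rs in
       if b = 0 \<or> b > 2
       then (1, (b, Stay) # (if s = 2 then 2 else 1, Stay) # (p, Stay) # keep ss)
       else (let (p', as) = control N D \<delta> b p (s # ss)
             in (0, (b, Go_Right) # hd as # (p', Stay) # tl as)))\<rparr>"

text \<open>The first program tape must not move because it is the output tape, which may hold only
  one letter, in cell 0.\<close>

definition wf_instr :: "nat \<Rightarrow> nat \<Rightarrow> (symbol list \<Rightarrow> (symbol \<times> dir) list) \<Rightarrow> bool" where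
  "wf_instr K N d \<longleftrightarrow> (\<forall>rs. length rs = K \<and> (\<forall>s \<in> set rs. s < N) \<longrightarrow>
     length (d rs) = K \<and> (\<forall>(s, e) \<in> set (d rs). s < N) \<and> snd (hd (d rs)) = Stay)"

context
  fixes K N D :: nat and \<delta> :: "nat \<Rightarrow> symbol list \<Rightarrow> (symbol \<times> dir) list"
  assumes K: "K \<ge> 2" and N: "2 * D + 4 \<le> N"
    and wf: "\<And>i. i < D \<Longrightarrow> wf_instr K N (\<delta> i)"
begin

text \<open>Capping at \<open>N - 1\<close> keeps the register a legal symbol on malformed input. As
  \<open>N\<close> is at least \<open>2 * D + 4\<close>, the values used by the codes of
  instructions below \<open>D\<close> are never capped.\<close>

lemma control_wf:
  assumes "length ss = K" "\<forall>s \<in> set ss. s < N" "b < N" "p < N"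
  shows "fst (control N D \<delta> b p ss) < N" "length (snd (control N D \<delta> b p ss)) = K"
    "\<forall>(s, e) \<in> set (snd (control N D \<delta> b p ss)). s < N"
    "snd (hd (snd (control N D \<delta> b p ss))) = Stay"
proof -
  obtain s0 s1 ss' where ss: "ss = s0 # s1 # ss'"
    using assms(1) K by (metis (no_types, opaque_lifting) Suc_le_length_iff numeral_2_eq_2)
  have *: "length (\<delta> i ss) = K" "\<forall>(s, e) \<in> set (\<delta> i ss). s < N" "snd (hd (\<delta> i ss)) = Stay"
    if "i < D" for i
    using wf[OF that] assms(1,2) by (auto simp: wf_instr_def)
  show "fst (control N D \<delta> b p ss) < N"
    using N assms by (auto simp: control_def)
  show "length (snd (control N D \<delta> b p ss)) = K"
    using assms(1) * by (auto simp: control_def ss)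
  show "\<forall>(s, e) \<in> set (snd (control N D \<delta> b p ss)). s < N"
    using assms *(2) unfolding control_def by (auto simp: ss keep_def)
  show "snd (hd (snd (control N D \<delta> b p ss))) = Stay"
    using * unfolding control_def by (auto simp: ss)
qed

lemma wf_stream_tm: "wf_tm (stream_tm K N D \<delta>)"
proof -
  have "fst (trans (stream_tm K N D \<delta>) q rs) \<le> 1 \<and>
        length (snd (trans (stream_tm K N D \<delta>) q rs)) = K + 2 \<and>
        (\<forall>(s, d) \<in> set (snd (trans (stream_tm K N D \<delta>) q rs)). s < N)"
    if rs: "length rs = K + 2" "\<forall>s \<in> set rs. s < N" for q rs
  proof -
    obtain b s p ss where e: "rs = b # s # p # ss"
      using rs(1) K by (metis (no_types, opaque_lifting) Suc_le_length_iff add_2_eq_Suc' numeral_2_eq_2 Suc_le_mono)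
    have l: "length (s # ss) = K" "\<forall>s \<in> set (s # ss). s < N" "b < N" "p < N"
      using rs by (auto simp: e)
    note c = control_wf[OF l]
    obtain p' as where pa: "control N D \<delta> b p (s # ss) = (p', as)"
      by (cases "control N D \<delta> b p (s # ss)")
    obtain a as' where as: "as = a # as'"
      using c(2) K pa by (cases as) auto
    show ?thesis
      using c rs N pa K unfolding stream_tm_def by (auto simp: e as keep_def Let_def)
  qed
  then show ?thesis
    using K N unfolding wf_tm_def by (auto simp: stream_tm_def)
qed

lemma map2_act_bounded:
  assumes "\<forall>(s, e) \<in> set as. s < N" "\<forall>t \<in> set ts. \<forall>i. fst t i < N"
  shows "\<forall>t \<in> set (map2 act as ts). \<forall>i. fst t i < N"
  using assms by (fastforce dest: set_zip_leftD set_zip_rightD)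

text \<open>Each input letter costs one machine step, which is one \<open>stream_step\<close> on the
  head-centred tapes. The bound \<open>N\<close> on all symbols is carried along so that
  \<open>control_wf\<close> applies.\<close>

lemma stream_tm_run:
  assumes "k \<le> length w"
  shows "\<exists>a rest c p. (step (stream_tm K N D \<delta>) ^^ k) (init_config (stream_tm K N D \<delta>) w) =
      (0, (str_contents w, int k) # (a, 0) # (c, 0) # rest) \<and>
      (\<forall>i. i \<noteq> 0 \<longrightarrow> a i = 0) \<and> c 0 = p \<and> p < N \<and> length rest = K - 1 \<and>
      (\<forall>t \<in> set ((a, 0) # rest). \<forall>i. fst t i < N) \<and>
      (p, map centre ((a, 0) # rest)) =
        fold (stream_step N D \<delta>) (take k w) (0, replicate K (\<lambda>_. 0))"
  using assms
proof (induction k)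
  case 0
  let ?a = "\<lambda>_::int. 0::symbol"
  have "str_contents [] = ?a"
    by (auto simp: str_contents_def)
  moreover have "replicate (K + 1) (?a, 0::int) = (?a, 0) # (?a, 0) # replicate (K - 1) (?a, 0)"
    using K by (cases K) auto
  moreover have "replicate K ?a = ?a # replicate (K - 1) ?a"
    using K by (cases K) auto
  ultimately show ?case
    using N by (intro exI[of _ ?a] exI[of _ "replicate (K - 1) (?a, 0)"] exI[of _ 0])
      (auto simp: init_config_def stream_tm_def)
next
  case (Suc k)
  let ?M = "stream_tm K N D \<delta>"
  obtain a rest c p where IH:
      "(step ?M ^^ k) (init_config ?M w) = (0, (str_contents w, int k) # (a, 0) # (c, 0) # rest)"
      "\<forall>i. i \<noteq> 0 \<longrightarrow> a i = 0" "c 0 = p" "p < N" "length rest = K - 1"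
      "\<forall>t \<in> set ((a, 0) # rest). \<forall>i. fst t i < N"
      "(p, map centre ((a, 0) # rest)) =
        fold (stream_step N D \<delta>) (take k w) (0, replicate K (\<lambda>_. 0))"
    using Suc by fastforce
  define b where "b = w ! k"
  have sc: "str_contents w (int k) = sym b"
    using Suc.prems by (auto simp: str_contents_def b_def)
  define ss where "ss = map scanned rest"
  obtain p' as where pa: "control N D \<delta> (sym b) p (a 0 # ss) = (p', as)"
    by (cases "control N D \<delta> (sym b) p (a 0 # ss)")
  have l: "length (a 0 # ss) = K"
    using IH(5) K by (simp add: ss_def)
  have scb: "scanned t < N" if "t \<in> set rest" for t
    using IH(6) that by (cases t) force
  have sN: "\<forall>s \<in> set (a 0 # ss). s < N"
    using IH(6) scb by (auto simp: ss_def)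
  have bN: "sym b < N"
    using N by auto
  note cw = control_wf[OF l sN bN IH(4), unfolded pa fst_conv snd_conv]
  obtain s as' where as: "as = (s, Stay) # as'"
    using cw(2,4) K by (cases as; cases "hd as") auto
  have tr: "trans ?M 0 (sym b # a 0 # p # ss) = (0, (sym b, Go_Right) # (s, Stay) # (p', Stay) # as')"
    using pa as by (auto simp: stream_tm_def Let_def)
  have st: "step ?M (0, (str_contents w, int k) # (a, 0) # (c, 0) # rest) =
      (0, (str_contents w, int (Suc k)) # (a(0 := s), 0) # (c(0 := p'), 0) # map2 act as' rest)"
    using tr sc IH(3) by (auto simp: stream_tm_def ss_def[symmetric] fun_upd_idem)
  have cen: "map centre ((a(0 := s), 0) # map2 act as' rest) = map2 cact as (map centre ((a, 0) # rest))"
    using map_centre_act[of as "(a, 0) # rest"] by (simp add: as del: cact.simps centre.simps)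
  have mp: "map (\<lambda>g. g 0) (map centre ((a, 0) # rest)) = a 0 # ss"
    by (simp add: ss_def)
  have "stream_step N D \<delta> b (p, map centre ((a, 0) # rest)) =
      (p', map centre ((a(0 := s), 0) # map2 act as' rest))"
    unfolding cen unfolding stream_step_def prod.case mp pa by simp
  moreover have "take (Suc k) w = take k w @ [b]"
    using Suc.prems by (simp add: b_def take_Suc_conv_app_nth)
  ultimately have f: "(p', map centre ((a(0 := s), 0) # map2 act as' rest)) =
      fold (stream_step N D \<delta>) (take (Suc k) w) (0, replicate K (\<lambda>_. 0))"
    by (simp add: IH(7)[symmetric] del: centre.simps)
  have bd: "\<forall>t \<in> set (map2 act as ((a, 0) # rest)). \<forall>i. fst t i < N"
    by (rule map2_act_bounded[OF cw(3) IH(6)])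
  show ?case
  proof (intro exI conjI)
    show "(step ?M ^^ Suc k) (init_config ?M w) =
        (0, (str_contents w, int (Suc k)) # (a(0 := s), 0) # (c(0 := p'), 0) # map2 act as' rest)"
      using IH(1) st by (simp del: step.simps)
    show "(p', map centre ((a(0 := s), 0) # map2 act as' rest)) =
        fold (stream_step N D \<delta>) (take (Suc k) w) (0, replicate K (\<lambda>_. 0))"
      by (rule f)
    show "\<forall>t \<in> set ((a(0 := s), 0) # map2 act as' rest). \<forall>i. fst t i < N"
      using bd as by simp
  qed (use IH cw as in auto)
qed

section \<open>The language decided by the stream machine\<close>

definition stream_lang :: lang where
  "stream_lang = {w. hd (snd (fold (stream_step N D \<delta>) w (0, replicate K (\<lambda>_. 0)))) 0 = 2}"

text \<open>One step per letter and one at the blank behind the input give the bound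
  \<open>[:1, 1:]\<close> on every input, whether or not it encodes a pair.\<close>

lemma stream_lang_P: "stream_lang \<in> P"
proof -
  let ?M = "stream_tm K N D \<delta>"
  have "computes_within ?M w [w \<in> stream_lang] (poly [:1, 1:] (length w))" for w
  proof -
    obtain a rest c p where r:
      "(step ?M ^^ length w) (init_config ?M w) =
         (0, (str_contents w, int (length w)) # (a, 0) # (c, 0) # rest)"
      "\<forall>i. i \<noteq> 0 \<longrightarrow> a i = 0"
      "(p, map centre ((a, 0) # rest)) = fold (stream_step N D \<delta>) w (0, replicate K (\<lambda>_. 0))"
      using stream_tm_run[of "length w" w] by auto
    have acc: "w \<in> stream_lang \<longleftrightarrow> a 0 = 2"
      unfolding stream_lang_def by (simp add: r(3)[symmetric])
    have sc: "str_contents w (int (length w)) = 0"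
      by (simp add: str_contents_def)
    have o: "a(0 := if a 0 = 2 then 2 else 1) = str_contents [a 0 = 2]"
      using r(2) by (auto simp: str_contents_def fun_eq_iff)
    have "(step ?M ^^ Suc (length w)) (init_config ?M w) =
        step ?M (0, (str_contents w, int (length w)) # (a, 0) # (c, 0) # rest)"
      using r(1) by simp
    also have "\<exists>ts. \<dots> = (num_states ?M, ts) \<and> fst (ts ! 1) = str_contents [a 0 = 2]"
      using sc o by (auto simp: stream_tm_def Let_def)
    finally show ?thesis
      unfolding computes_within_def acc by (intro exI[of _ "Suc (length w)"]) auto
  qed
  then show ?thesis
    using wf_stream_tm unfolding P_def FP_def by blast
qed

lemma stream_step_x:
  "fold (stream_step N D \<delta>) (concat (map (\<lambda>b. [True, b]) x)) (0, replicate K (\<lambda>_. 0)) =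
   (0, init_tapes K x)"
proof (induction x rule: rev_induct)
  case Nil
  have "replicate K (\<lambda>_. 0) = (\<lambda>_. 0) # (\<lambda>_. 0) # replicate (K - 2) (\<lambda>_::int. 0::symbol)"
    using K by (metis (no_types, lifting) Suc_diff_Suc add_2_eq_Suc le_add_diff_inverse replicate_Suc)
  then show ?case
    by (simp add: init_tapes_def)
next
  case (snoc b x)
  show ?case
    unfolding map_append concat_append fold_append comp_def snoc
    using map2_cact_keep[of "replicate (K - 2) (\<lambda>_. 0)"] cact_str_contents[of b x]
      cact_keep[of "\<lambda>_. 0"]
    by (cases b) (simp_all add: stream_step_def control_def init_tapes_def map2_cact_keep
        del: cact.simps map_replicate)
qed

lemma stream_step_skip:
  assumes "j \<le> D" "j + i \<le> D"
  shows "fold (stream_step N D \<delta>) (concat (map (\<lambda>b. [True, b]) (replicate i True))) (2 + 2 * j, gs) =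
   (2 + 2 * (j + i), gs)"
  using assms
proof (induction i arbitrary: j)
  case (Suc i)
  have "fold (stream_step N D \<delta>) [True, True] (2 + 2 * j, gs) = (2 + 2 * Suc j, gs)"
    using Suc.prems N by (simp add: stream_step_def control_def map2_cact_keep)
  then show ?case
    using Suc.IH[of "Suc j"] Suc.prems by simp
qed simp

lemma stream_step_code:
  assumes "i < D"
  shows "fold (stream_step N D \<delta>) (concat (map (\<lambda>b. [True, b]) (replicate i True @ [False]))) (2, gs) =
   (2, exec \<delta> i gs)"
proof -
  have "fold (stream_step N D \<delta>) [True, False] (2 + 2 * i, gs) = (2, exec \<delta> i gs)"
    using assms N by (simp add: stream_step_def control_def map2_cact_keep exec_def)
  then show ?thesis
    using stream_step_skip[of 0 i gs] assms by simp
qed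

lemma stream_step_program:
  assumes "set is \<subseteq> {..<D}"
  shows "fold (stream_step N D \<delta>)
     (concat (map (\<lambda>b. [True, b]) (concat (map (\<lambda>i. replicate i True @ [False]) is)))) (2, gs) =
   (2, fold (exec \<delta>) is gs)"
  using assms
proof (induction "is" arbitrary: gs)
  case (Cons i "is")
  then show ?case
    using stream_step_code[of i gs] by (simp del: replicate.simps)
qed simp

lemma stream_lang_iff:
  assumes "set is \<subseteq> {..<D}"
  shows "encode_pair x (concat (map (\<lambda>i. replicate i True @ [False]) is)) \<in> stream_lang \<longleftrightarrow>
     hd (fold (exec \<delta>) is (init_tapes K x)) 0 = 2"
proof -
  \<comment> \<open>The 0 that closes \<open>x\<close> switches the register from 0 to 2; the 0 that
    closes the advice leaves it at 2.\<close>
  have "stream_step N D \<delta> False (0, gs) = (2, gs)" "stream_step N D \<delta> False (2, gs) = (2, gs)" for gs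
    by (simp_all add: stream_step_def control_def map2_cact_keep)
  then show ?thesis
    by (simp add: stream_lang_def encode_pair_def encode_tuple_def encode_item_def stream_step_x
        stream_step_program[OF assms])
qed

end

text \<open>The instructions are numbered, and number \<open>i\<close> is coded in unary by
  \<open>i\<close> letters 1 and a final 0. As numbers stay below the size of the type, no code is
  longer than that size.\<close>

lemma program_decider:
  fixes \<delta> :: "'i::finite \<Rightarrow> symbol list \<Rightarrow> (symbol \<times> dir) list"
  assumes "K \<ge> 2" "2 * card (UNIV :: 'i set) + 4 \<le> N" "\<And>i. wf_instr K N (\<delta> i)"
  obtains A and code :: "'i \<Rightarrow> str" where "A \<in> P" "\<And>i. length (code i) \<le> card (UNIV :: 'i set)"
    "\<And>x is. encode_pair x (concat (map code is)) \<in> A \<longleftrightarrow>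
       hd (fold (exec \<delta>) is (init_tapes K x)) 0 = 2"
proof -
  obtain idx :: "'i \<Rightarrow> nat" where idx: "bij_betw idx UNIV {..<card (UNIV :: 'i set)}"
    using ex_bij_betw_finite_nat[of "UNIV :: 'i set"] by (auto simp: lessThan_atLeast0)
  define dec where "dec = inv_into UNIV idx"
  have dec: "dec (idx i) = i" for i
    using idx by (simp add: dec_def bij_betw_def)
  have lt: "idx i < card (UNIV :: 'i set)" for i
    using idx by (auto simp: bij_betw_def)
  have wf: "wf_instr K N ((\<delta> \<circ> dec) i)" for i
    using assms(3) by simp
  let ?code = "\<lambda>i. replicate (idx i) True @ [False]"
  have ex: "exec \<delta> i = exec (\<delta> \<circ> dec) (idx i)" for i
    by (rule ext) (simp add: exec_def dec)
  have "fold (exec \<delta>) is = fold (exec (\<delta> \<circ> dec)) (map idx is)" for "is"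
    by (simp add: fold_map comp_def ex[abs_def])
  moreover have "set (map idx is) \<subseteq> {..<card (UNIV :: 'i set)}" for "is"
    using lt by auto
  ultimately have "encode_pair x (concat (map ?code is)) \<in> stream_lang K N (card (UNIV :: 'i set)) (\<delta> \<circ> dec) \<longleftrightarrow>
       hd (fold (exec \<delta>) is (init_tapes K x)) 0 = 2" for x "is"
    using stream_lang_iff[OF assms(1,2) wf, of "map idx is" x] by (simp add: comp_def)
  moreover have "length (?code i) \<le> card (UNIV :: 'i set)" for i
    using lt[of i] by simp
  ultimately show ?thesis
    using that[of "stream_lang K N (card (UNIV :: 'i set)) (\<delta> \<circ> dec)" ?code]
      stream_lang_P[OF assms(1,2), of "\<delta> \<circ> dec"] wf by blast
qed

section \<open>The instruction set\<close>

text \<open>\<open>XLeft\<close> to \<open>Hit\<close> serve to compare \<open>x\<close> with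
  strings of the advice; \<open>Emit\<close> and \<open>EmitX\<close> write the selector's input;
  \<open>Rewind\<close> and \<open>Run\<close> simulate its machine; \<open>OutLeft\<close> to
  \<open>Match\<close> find and read its output; the last two erase the tapes.\<close>

datatype instr = XLeft | Cmp bool | ReqLess | ReqGreater | Hit | Emit bool | EmitX | Rewind | Run
  | OutLeft | OutSeek | OutRight | Match | AllRight | EraseLeft

instance instr :: finite
proof
  have "(i::instr) \<in> {XLeft, ReqLess, ReqGreater, Hit, EmitX, Rewind, Run, OutLeft, OutSeek, OutRight,
     Match, AllRight, EraseLeft} \<union> range Cmp \<union> range Emit" for i
    by (cases i) auto
  then have "(UNIV :: instr set) \<subseteq> {XLeft, ReqLess, ReqGreater, Hit, EmitX, Rewind, Run, OutLeft,
     OutSeek, OutRight, Match, AllRight, EraseLeft} \<union> range Cmp \<union> range Emit"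
    by blast
  then show "finite (UNIV :: instr set)"
    by (rule finite_subset) auto
qed

text \<open>The tapes are: acceptance flag \<open>a\<close>, the string \<open>x\<close>, the simulated state \<open>q\<close>, the comparison
  register \<open>f\<close> (0: equal so far, 1: less, 2: greater), the guard \<open>g\<close> (0: still satisfied), and then
  the tapes \<open>ms\<close> of the simulated machine. All but \<open>x\<close> and \<open>ms\<close> never move.\<close>

abbreviation regs ::
  "symbol \<Rightarrow> symbol \<Rightarrow> dir \<Rightarrow> symbol \<Rightarrow> symbol \<Rightarrow> symbol \<Rightarrow> (symbol \<times> dir) list \<Rightarrow> (symbol \<times> dir) list"
  where "regs a x d q f g as \<equiv> (a, Stay) # (x, d) # (q, Stay) # (f, Stay) # (g, Stay) # as"

text \<open>\<open>Run\<close> tests the scanned symbols since the decider's alphabet is larger than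
  that of \<open>M\<close>, outside of which \<open>trans\<close> is unconstrained. Past halting it
  does nothing, so a fixed number of copies replaces a loop. \<open>EraseLeft\<close> also resets
  \<open>q\<close> and \<open>g\<close> for the next query.\<close>

fun acts :: "tm \<Rightarrow> instr \<Rightarrow> symbol \<Rightarrow> symbol \<Rightarrow> symbol \<Rightarrow> symbol \<Rightarrow> symbol \<Rightarrow> symbol list \<Rightarrow>
    (symbol \<times> dir) list" where
  "acts M XLeft a x q f g ms = regs a x Go_Left q f g (keep ms)"
| "acts M (Cmp b) a x q f g ms =
     regs a x Go_Right q
       (if f = 0 then if x = sym b then 0 else if x < sym b then 1 else 2 else f) g (keep ms)"
| "acts M ReqLess a x q f g ms = regs a x Stay q 0 (if f = 1 then g else 1) (keep ms)"
| "acts M ReqGreater a x q f g ms = regs a x Stay q 0 (if f = 2 then g else 1) (keep ms)"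
| "acts M Hit a x q f g ms = regs (if f = 0 \<and> g = 0 then 2 else a) x Stay q 0 g (keep ms)"
| "acts M (Emit b) a x q f g ms = regs a x Stay q f g ((keep ms)[0 := (sym b, Go_Right)])"
| "acts M EmitX a x q f g ms = regs a x Go_Right q f g ((keep ms)[0 := (x, Go_Right)])"
| "acts M Rewind a x q f g ms = regs a x Stay q f g ((keep ms)[0 := (ms ! 0, Go_Left)])"
| "acts M Run a x q f g ms =
     (if q < num_states M \<and> (\<forall>s \<in> set ms. s < num_symbols M)
      then regs a x Stay (fst (trans M q ms)) f g (snd (trans M q ms))
      else regs a x Stay q f g (keep ms))"
| "acts M OutLeft a x q f g ms = regs a x Stay q f g ((keep ms)[1 := (ms ! 1, Go_Left)])"
| "acts M OutSeek a x q f g ms =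
     regs a x Stay q f g ((keep ms)[1 := (ms ! 1, if ms ! 1 = 0 then Go_Right else Stay)])"
| "acts M OutRight a x q f g ms = regs a x Stay q f g ((keep ms)[1 := (ms ! 1, Go_Right)])"
| "acts M Match a x q f g ms =
     regs a x Go_Right q (if x = ms ! 1 then f else 1) g ((keep ms)[1 := (ms ! 1, Go_Right)])"
| "acts M AllRight a x q f g ms = regs a x Stay q f g (map (\<lambda>s. (s, Go_Right)) ms)"
| "acts M EraseLeft a x q f g ms = regs a x Stay 0 f 0 (map (\<lambda>s. (0, Go_Left)) ms)"

definition delta :: "tm \<Rightarrow> instr \<Rightarrow> symbol list \<Rightarrow> (symbol \<times> dir) list" where
  "delta M i rs = acts M i (rs ! 0) (rs ! 1) (rs ! 2) (rs ! 3) (rs ! 4) (drop 5 rs)"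

lemma ball_keep_update:
  assumes "\<forall>s \<in> set ms. s < N" "s' < N"
  shows "\<forall>(s, e) \<in> set ((keep ms)[j := (s', d)]). s < N"
proof -
  have "set ((keep ms)[j := (s', d)]) \<subseteq> insert (s', d) (set (keep ms))"
    by (rule set_update_subset_insert)
  with assms show ?thesis
    by (fastforce simp: keep_def)
qed

lemma ball_keep: "\<forall>s \<in> set ms. s < N \<Longrightarrow> \<forall>(s, e) \<in> set (keep ms). s < N"
  by (auto simp: keep_def)

lemma wf_delta:
  assumes wf: "wf_tm M" and N: "N \<ge> 3" "N \<ge> num_symbols M" "N > num_states M"
  shows "wf_instr (num_tapes M + 5) N (delta M i)"
  unfolding wf_instr_def
proof (intro allI impI)
  fix rs
  assume rs: "length rs = num_tapes M + 5 \<and> (\<forall>s \<in> set rs. s < N)"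
  obtain a x q f g ms where e: "rs = a # x # q # f # g # ms"
    using rs by (auto simp: numeral_eq_Suc length_Suc_conv add.commute[of _ "Suc _"])
  have ms: "length ms = num_tapes M" "\<forall>s \<in> set ms. s < N"
    and v: "a < N" "x < N" "q < N" "f < N" "g < N"
    using rs by (auto simp: e)
  have k: "num_tapes M \<ge> 2"
    using wf by (simp add: wf_tm_def)
  have nth: "ms ! 0 < N" "ms ! 1 < N"
    using ms k by (auto simp: nth_mem)
  have run: "fst (trans M q ms) < N" "length (snd (trans M q ms)) = num_tapes M"
     "\<forall>(s, e) \<in> set (snd (trans M q ms)). s < N"
    if "q < num_states M" "\<forall>s \<in> set ms. s < num_symbols M"
  proof -
    have *: "fst (trans M q ms) \<le> num_states M" "length (snd (trans M q ms)) = num_tapes M"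
        "\<forall>(s, d) \<in> set (snd (trans M q ms)). s < num_symbols M"
      using that wf ms(1) unfolding wf_tm_def by auto
    show "fst (trans M q ms) < N" "length (snd (trans M q ms)) = num_tapes M"
        "\<forall>(s, e) \<in> set (snd (trans M q ms)). s < N"
      using * N by fastforce+
  qed
  define ok where "ok = (\<lambda>as :: (symbol \<times> dir) list. \<forall>(s, e) \<in> set as. s < N)"
  have ok: "ok ((s, e) # as) \<longleftrightarrow> s < N \<and> ok as" "ok (keep ms)" "ok (map (\<lambda>s. (s, Go_Right)) ms)"
      "ok (map (\<lambda>s. (0, Go_Left)) ms)" "s < N \<Longrightarrow> ok ((keep ms)[j := (s, e)])" for s e as j
    using ball_keep[OF ms(2)] ball_keep_update[OF ms(2)] ms(2) N(1) unfolding ok_def by auto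
  have ok_run: "ok (snd (trans M q ms))" if "q < num_states M" "\<forall>s \<in> set ms. s < num_symbols M"
    using run(3)[OF that] by (simp add: ok_def)
  have d: "delta M i rs = acts M i a x q f g ms"
    by (simp add: delta_def e)
  have "length (acts M i a x q f g ms) = num_tapes M + 5 \<and> snd (hd (acts M i a x q f g ms)) = Stay"
    using ms(1) run(2) by (cases i) auto
  moreover have "ok (acts M i a x q f g ms)"
    using v nth N(1) run(1) by (cases i) (auto simp: ok ok_run simp del: One_nat_def)
  ultimately show "length (delta M i rs) = num_tapes M + 5 \<and>
      (\<forall>(s, e) \<in> set (delta M i rs). s < N) \<and> snd (hd (delta M i rs)) = Stay"
    unfolding d ok_def by blast
qed

section \<open>Effect of single instructions\<close>

definition reg :: "symbol \<Rightarrow> ctape" where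
  "reg v = (\<lambda>i. if i = 0 then v else 0)"

definition St :: "symbol \<Rightarrow> ctape \<Rightarrow> symbol \<Rightarrow> symbol \<Rightarrow> symbol \<Rightarrow> ctape list \<Rightarrow> ctape list" where
  "St a X q f g ms = reg a # X # reg q # reg f # reg g # ms"

lemma cact_reg: "cact (s, Stay) (reg v) = reg s"
  by (auto simp: reg_def fun_eq_iff)

lemma exec_St:
  "exec (delta M) i (St a X q f g ms) =
     map2 cact (acts M i a (X 0) q f g (map (\<lambda>g. g 0) ms)) (St a X q f g ms)"
  by (simp add: exec_def delta_def St_def reg_def)

lemma map2_cact_regs:
  "map2 cact (regs a' x' d q' f' g' as) (St a X q f g ms) =
     St a' (cact (x', d) X) q' f' g' (map2 cact as ms)"
  by (simp add: St_def cact_reg del: cact.simps)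

lemma map2_cact_keep_update:
  "j < length gs \<Longrightarrow> map2 cact ((keep (map (\<lambda>g. g 0) gs))[j := a]) gs = gs[j := cact a (gs ! j)]"
proof (induction gs arbitrary: j)
  case (Cons g gs)
  then show ?case
    by (cases j) (simp_all add: map2_cact_keep cact_keep del: cact.simps)
qed simp

lemma map2_cact_map: "map2 cact (map (\<lambda>s. (h s, d)) (map (\<lambda>g. g 0) gs)) gs = map (\<lambda>g. cact (h (g 0), d) g) gs"
  by (induction gs) (simp_all del: cact.simps)

definition seek :: "ctape \<Rightarrow> ctape" where
  "seek g = (if g 0 = 0 then shift 1 g else g)"

definition erase_left :: "ctape \<Rightarrow> ctape" where
  "erase_left = cact (0, Go_Left)"

lemma cact_seek: "cact (g 0, if g 0 = 0 then Go_Right else Stay) g = seek g"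
  by (cases "g 0 = 0") (auto simp: seek_def shift_def)

context
  fixes M :: tm and E :: "instr \<Rightarrow> ctape list \<Rightarrow> ctape list"
  defines "E \<equiv> exec (delta M)"
begin

declare fold_replicate [simp del]

lemmas exec_simps = exec_St map2_cact_regs map2_cact_keep map2_cact_keep_update cact_keep

lemma exec_instr [simp]:
  "E XLeft (St a X q f g ms) = St a (shift (-1) X) q f g ms"
  "E (Cmp b) (St a X q f g ms) =
     St a (shift 1 X) q (if f = 0 then if X 0 = sym b then 0 else if X 0 < sym b then 1 else 2 else f) g ms"
  "E ReqLess (St a X q f g ms) = St a X q 0 (if f = 1 then g else 1) ms"
  "E ReqGreater (St a X q f g ms) = St a X q 0 (if f = 2 then g else 1) ms"
  "E Hit (St a X q f g ms) = St (if f = 0 \<and> g = 0 then 2 else a) X q 0 g ms"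
  "E AllRight (St a X q f g ms) = St a X q f g (map (shift 1) ms)"
  "E EraseLeft (St a X q f g ms) = St a X 0 f 0 (map erase_left ms)"
  by (simp_all add: E_def exec_simps map2_cact_map erase_left_def del: cact.simps map_map)

lemma exec_instr_tape [simp]:
  assumes "length ms \<ge> 2"
  shows
  "E (Emit b) (St a X q f g ms) = St a X q f g (ms[0 := cact (sym b, Go_Right) (ms ! 0)])"
  "E EmitX (St a X q f g ms) = St a (shift 1 X) q f g (ms[0 := cact (X 0, Go_Right) (ms ! 0)])"
  "E Rewind (St a X q f g ms) = St a X q f g (ms[0 := shift (-1) (ms ! 0)])"
  "E OutLeft (St a X q f g ms) = St a X q f g (ms[1 := shift (-1) (ms ! 1)])"
  "E OutSeek (St a X q f g ms) = St a X q f g (ms[1 := seek (ms ! 1)])"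
  "E OutRight (St a X q f g ms) = St a X q f g (ms[1 := shift 1 (ms ! 1)])"
  "E Match (St a X q f g ms) =
     St a (shift 1 X) q (if X 0 = (ms ! 1) 0 then f else 1) g (ms[1 := shift 1 (ms ! 1)])"
proof -
  have l: "0 < length ms" "1 < length ms"
    using assms by auto
  then have n: "map (\<lambda>g. g 0) ms ! 0 = (ms ! 0) 0" "map (\<lambda>g. g 0) ms ! 1 = (ms ! 1) 0"
    by auto
  show
  "E (Emit b) (St a X q f g ms) = St a X q f g (ms[0 := cact (sym b, Go_Right) (ms ! 0)])"
  "E EmitX (St a X q f g ms) = St a (shift 1 X) q f g (ms[0 := cact (X 0, Go_Right) (ms ! 0)])"
  "E Rewind (St a X q f g ms) = St a X q f g (ms[0 := shift (-1) (ms ! 0)])"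
  "E OutLeft (St a X q f g ms) = St a X q f g (ms[1 := shift (-1) (ms ! 1)])"
  "E OutSeek (St a X q f g ms) = St a X q f g (ms[1 := seek (ms ! 1)])"
  "E OutRight (St a X q f g ms) = St a X q f g (ms[1 := shift 1 (ms ! 1)])"
  "E Match (St a X q f g ms) =
     St a (shift 1 X) q (if X 0 = (ms ! 1) 0 then f else 1) g (ms[1 := shift 1 (ms ! 1)])"
    unfolding E_def exec_St acts.simps map2_cact_regs n map2_cact_keep_update[OF l(1)]
      map2_cact_keep_update[OF l(2)] cact_move cact_keep cact_seek
    by (rule refl)+
qed

section \<open>Simulating the selector's machine, and loops of one instruction\<close>

definition wf_cconfig :: "nat \<times> ctape list \<Rightarrow> bool" where
  "wf_cconfig = (\<lambda>(q, gs). q \<le> num_states M \<and> length gs = num_tapes M \<and>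
     (\<forall>g \<in> set gs. \<forall>i. g i < num_symbols M))"

lemma wf_cconfig_cstep:
  assumes "wf_tm M" "wf_cconfig c"
  shows "wf_cconfig (cstep M c)"
proof -
  obtain q gs where c: "c = (q, gs)"
    by (cases c)
  show ?thesis
  proof (cases "q < num_states M")
    case True
    obtain q' as where t: "trans M q (map (\<lambda>g. g 0) gs) = (q', as)"
      by (cases "trans M q (map (\<lambda>g. g 0) gs)")
    have "length (map (\<lambda>g. g 0) gs) = num_tapes M \<and> (\<forall>s \<in> set (map (\<lambda>g. g 0) gs). s < num_symbols M)"
      using assms(2) by (auto simp: wf_cconfig_def c)
    then have w: "q' \<le> num_states M" "length as = num_tapes M" "\<forall>(s, d) \<in> set as. s < num_symbols M"
      using assms(1) True t unfolding wf_tm_def by fastforce+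
    have "cact a g i < num_symbols M" if "(a, g) \<in> set (zip as gs)" for a g i
    proof -
      have "a \<in> set as" "g \<in> set gs"
        using that by (auto dest: set_zip_leftD set_zip_rightD)
      then show ?thesis
        using w(3) assms(2) by (cases a) (auto simp: wf_cconfig_def c)
    qed
    then show ?thesis
      using True w assms(2) by (auto simp: wf_cconfig_def cstep_def c t)
  qed (use assms in \<open>simp add: cstep_def c\<close>)
qed

text \<open>Well-formedness makes the symbol test in \<open>Run\<close> succeed; in the halting
  state both sides change nothing.\<close>

lemma exec_Run:
  assumes "wf_cconfig (q, ms)"
  shows "E Run (St a X q f g ms) =
     St a X (fst (cstep M (q, ms))) f g (snd (cstep M (q, ms)))"
proof (cases "q < num_states M")
  case True
  moreover have "\<forall>s \<in> set (map (\<lambda>g. g 0) ms). s < num_symbols M"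
    using assms by (auto simp: wf_cconfig_def)
  ultimately show ?thesis
    by (simp add: E_def exec_simps cstep_def del: cact.simps split: prod.split)
next
  case False
  then show ?thesis
    by (simp add: E_def exec_simps cstep_def del: cact.simps)
qed

lemma fold_Run:
  assumes "wf_tm M" "wf_cconfig (q, ms)"
  shows "fold E (replicate t Run) (St a X q f g ms) =
     St a X (fst ((cstep M ^^ t) (q, ms))) f g (snd ((cstep M ^^ t) (q, ms)))"
  using assms(2)
proof (induction t arbitrary: q ms)
  case (Suc t)
  obtain q' ms' where c: "cstep M (q, ms) = (q', ms')"
    by (cases "cstep M (q, ms)")
  then have "wf_cconfig (q', ms')"
    using wf_cconfig_cstep[OF assms(1) Suc.prems] by simp
  then show ?case
    using Suc.IH[of q' ms'] c by (simp add: exec_Run[OF Suc.prems] funpow_swap1)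
qed simp

lemma fold_XLeft:
  "fold E (replicate j XLeft) (St a X q f g ms) = St a (shift (- int j) X) q f g ms"
  by (induction j arbitrary: X) (auto simp: algebra_simps)

lemma fold_AllRight:
  "fold E (replicate j AllRight) (St a X q f g ms) = St a X q f g (map (shift (int j)) ms)"
proof (induction j arbitrary: ms)
  case 0
  have "shift 0 = id" by auto
  then show ?case by simp
next
  case (Suc j)
  then show ?case by (simp add: comp_def algebra_simps)
qed

lemma fold_EraseLeft:
  "fold E (replicate (Suc j) EraseLeft) (St a X q f g ms) = St a X 0 f 0 (map (erase_left ^^ Suc j) ms)"
proof -
  have "fold E (replicate j EraseLeft) (St a X 0 f 0 ms) = St a X 0 f 0 (map (erase_left ^^ j) ms)" for ms
    by (induction j arbitrary: ms) (simp_all add: funpow_swap1 comp_def)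
  then show ?thesis
    by (simp add: funpow_swap1 comp_def)
qed

lemma fold_Rewind:
  "fold E (replicate j Rewind) (St a X q f g (G # G' # ms)) = St a X q f g (shift (- int j) G # G' # ms)"
  by (induction j arbitrary: G) (auto simp: algebra_simps)

lemma fold_OutLeft:
  "length ms \<ge> 2 \<Longrightarrow> fold E (replicate j OutLeft) (St a X q f g ms) =
     St a X q f g (ms[1 := shift (- int j) (ms ! 1)])"
  by (induction j arbitrary: ms) (auto simp: algebra_simps)

lemma fold_OutSeek:
  "length ms \<ge> 2 \<Longrightarrow> fold E (replicate j OutSeek) (St a X q f g ms) =
     St a X q f g (ms[1 := (seek ^^ j) (ms ! 1)])"
  by (induction j arbitrary: ms) (auto simp: funpow_swap1)

subsection \<open>Comparing with x\<close>

fun cmp :: "nat \<Rightarrow> str \<Rightarrow> str \<Rightarrow> nat" where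
  "cmp f (b # x) (c # y) =
     cmp (if f = 0 then if b = c then 0 else if b < c then 1 else 2 else f) x y"
| "cmp f _ _ = f"

lemma cmp_nonzero: "f \<noteq> 0 \<Longrightarrow> cmp f x y = f"
  by (induction f x y rule: cmp.induct) auto

text \<open>The first difference settles the verdict. Equal lengths matter: \<open>cmp\<close> would
  take a proper prefix for an equal word.\<close>

lemma cmp_0:
  "length x = length y \<Longrightarrow> cmp 0 x y = (if x = y then 0 else if lex_less x y then 1 else 2)"
  by (induction x y rule: list_induct2) (auto simp: cmp_nonzero lex_less_def)

lemma lex_less_linear: "x = y \<or> lex_less x y \<or> lex_less y x"
  using lexord_linear[of "{(False, True)}" x y] by (auto simp: lex_less_def)

lemma lex_less_irrefl: "\<not> lex_less x x"
  by (auto simp: lex_less_def lexord_irreflexive)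

lemma lex_less_trans: "lex_less x y \<Longrightarrow> lex_less y z \<Longrightarrow> lex_less x z"
  unfolding lex_less_def by (erule lexord_trans) (auto intro: transI)

lemma lex_less_asym: "lex_less x y \<Longrightarrow> \<not> lex_less y x"
  using lex_less_trans[of x y x] lex_less_irrefl by blast

lemma fold_Cmp:
  assumes "i + length y \<le> length x"
  shows "fold E (map Cmp y) (St a (shift (int i) (str_contents x)) q f g ms) =
     St a (shift (int (i + length y)) (str_contents x)) q (cmp f (drop i x) y) g ms"
  using assms
proof (induction y arbitrary: i f)
  case Nil
  then show ?case by (cases "drop i x") auto
next
  case (Cons b y)
  have d: "drop i x = x ! i # drop (Suc i) x"
    using Cons.prems by (simp add: Cons_nth_drop_Suc)
  have s: "str_contents x (int i) = sym (x ! i)"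
    using Cons.prems by (simp add: str_contents_def)
  have i: "1 + int i = int (Suc i)" by simp
  show ?case
    using Cons.IH[of "Suc i"] Cons.prems by (auto simp: d s i simp del: of_nat_Suc)
qed

definition check :: "instr \<Rightarrow> str \<Rightarrow> instr list" where
  "check r y = map Cmp y @ [r] @ replicate (length y) XLeft"

lemma fold_check:
  assumes "length y = length x"
  shows "fold E (check ReqLess y) (St a (str_contents x) q 0 g ms) =
       St a (str_contents x) q 0 (if lex_less x y then g else 1) ms"
    "fold E (check ReqGreater y) (St a (str_contents x) q 0 g ms) =
       St a (str_contents x) q 0 (if lex_less y x then g else 1) ms"
    "fold E (check Hit y) (St a (str_contents x) q 0 0 ms) =
       St (if x = y then 2 else a) (str_contents x) q 0 0 ms"
proof -
  have c: "fold E (map Cmp y) (St a (str_contents x) q 0 g ms) =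
      St a (shift (int (length x)) (str_contents x)) q
        (if x = y then 0 else if lex_less x y then 1 else 2) g ms" for g
    using fold_Cmp[of 0 y x a q 0 g ms] assms cmp_0[of x y] by simp
  define r where "r = (if x = y then 0 else if lex_less x y then 1 else 2 :: nat)"
  have r: "r = 0 \<longleftrightarrow> x = y" "r = 1 \<longleftrightarrow> lex_less x y" "r = 2 \<longleftrightarrow> lex_less y x"
    using lex_less_linear[of x y] lex_less_irrefl[of x] lex_less_asym[of x y]
    by (auto simp: r_def)
  show "fold E (check ReqLess y) (St a (str_contents x) q 0 g ms) =
       St a (str_contents x) q 0 (if lex_less x y then g else 1) ms"
    by (simp add: check_def fold_XLeft c[folded r_def] assms r(2)[simplified])
  show "fold E (check ReqGreater y) (St a (str_contents x) q 0 g ms) =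
       St a (str_contents x) q 0 (if lex_less y x then g else 1) ms"
    by (simp add: check_def fold_XLeft c[folded r_def] assms r(3)[simplified])
  show "fold E (check Hit y) (St a (str_contents x) q 0 0 ms) =
       St (if x = y then 2 else a) (str_contents x) q 0 0 ms"
    by (simp add: check_def fold_XLeft c[folded r_def] assms r(1)[simplified])
qed

lemma fold_checks_less:
  assumes "\<forall>y \<in> set ys. length y = length x"
  shows "fold E (concat (map (check ReqLess) ys)) (St a (str_contents x) q 0 g ms) =
       St a (str_contents x) q 0 (if \<forall>y \<in> set ys. lex_less x y then g else 1) ms"
  using assms by (induction ys arbitrary: g) (auto simp: fold_check)

lemma fold_checks_greater:
  assumes "\<forall>y \<in> set ys. length y = length x"
  shows "fold E (concat (map (check ReqGreater) ys)) (St a (str_contents x) q 0 g ms) =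
       St a (str_contents x) q 0 (if \<forall>y \<in> set ys. lex_less y x then g else 1) ms"
  using assms by (induction ys arbitrary: g) (auto simp: fold_check)

lemma fold_checks_hit:
  assumes "\<forall>y \<in> set ys. length y = length x"
  shows "fold E (concat (map (check Hit) ys)) (St a (str_contents x) q 0 0 ms) =
       St (if x \<in> set ys then 2 else a) (str_contents x) q 0 0 ms"
  using assms by (induction ys arbitrary: a) (auto simp: fold_check)

subsection \<open>Writing the input of the selector\<close>

definition loaded :: "nat \<Rightarrow> str \<Rightarrow> ctape list" where
  "loaded k u = shift (int (length u)) (str_contents u) # replicate k (\<lambda>_. 0)"

lemma fold_Emit:
  assumes "k \<ge> 1"
  shows "fold E (map Emit v) (St a X q f g (loaded k u)) = St a X q f g (loaded k (u @ v))"
proof (induction v arbitrary: u)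
  case (Cons b v)
  have "E (Emit b) (St a X q f g (loaded k u)) = St a X q f g (loaded k (u @ [b]))"
    using assms cact_str_contents[of b u]
    by (subst exec_instr_tape) (auto simp: loaded_def simp del: cact.simps)
  then show ?case
    using Cons[of "u @ [b]"] by simp
qed simp

definition emit_x :: "nat \<Rightarrow> instr list" where
  "emit_x m = concat (replicate m [Emit True, EmitX]) @ [Emit False] @ replicate m XLeft"

lemma fold_EmitX:
  assumes "k \<ge> 1" "i + j = length x"
  shows "fold E (concat (replicate j [Emit True, EmitX])) (St a (shift (int i) (str_contents x)) q f g (loaded k u)) =
     St a (shift (int (length x)) (str_contents x)) q f g
       (loaded k (u @ concat (map (\<lambda>b. [True, b]) (drop i x))))"
  using assms(2)
proof (induction j arbitrary: i u)
  case (Suc j)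
  have d: "drop i x = x ! i # drop (Suc i) x"
    using Suc.prems by (simp add: Cons_nth_drop_Suc)
  have s: "shift (int i) (str_contents x) 0 = sym (x ! i)"
    using Suc.prems by (simp add: str_contents_def)
  have e: "E (Emit True) (St a (shift (int i) (str_contents x)) q f g (loaded k u)) =
      St a (shift (int i) (str_contents x)) q f g (loaded k (u @ [True]))"
    using fold_Emit[OF assms(1), of "[True]"] by simp
  have "E EmitX (St a (shift (int i) (str_contents x)) q f g (loaded k (u @ [True]))) =
      St a (shift (int (Suc i)) (str_contents x)) q f g (loaded k (u @ [True, x ! i]))"
    using assms(1) cact_str_contents[of "x ! i" "u @ [True]"]
    by (subst exec_instr_tape, unfold s) (auto simp: loaded_def simp del: cact.simps)
  then show ?case
    using Suc.IH[of "Suc i" "u @ [True, x ! i]"] Suc.prems e by (simp add: d)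
qed simp

lemma fold_emit_x:
  assumes "k \<ge> 1"
  shows "fold E (emit_x (length x)) (St a (str_contents x) q f g (loaded k u)) =
     St a (str_contents x) q f g (loaded k (u @ encode_item x))"
  using fold_EmitX[OF assms, of 0 "length x" x a q f g u] fold_Emit[OF assms, of "[False]"]
  by (simp add: emit_x_def fold_XLeft encode_item_def)

subsection \<open>Scanning the output of the selector\<close>

text \<open>An encoded string of length \<open>m\<close> takes 2m+1 cells: markers and letters
  alternate, then comes the closing 0. \<open>OutRight\<close> skips the markers and the closing 0;
  \<open>Hit\<close> accepts a full match under a satisfied guard and clears the comparison register
  for the next item.\<close>

definition scan_item :: "nat \<Rightarrow> instr list" where
  "scan_item m = concat (replicate m [OutRight, Match]) @ [Hit, OutRight] @ replicate m XLeft"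

lemma concat_replicate_Suc: "concat (replicate (Suc j) xs) = concat (replicate j xs) @ xs"
  by (induction j) auto

lemma fold_Match:
  assumes "length ms \<ge> 2"
  shows "fold E (concat (replicate j [OutRight, Match])) (St a X q 0 g ms) =
     St a (shift (int j) X) q (if \<forall>t<j. X (int t) = (ms ! 1) (2 * int t + 1) then 0 else 1) g
       (ms[1 := shift (2 * int j) (ms ! 1)])"
proof (induction j)
  case (Suc j)
  show ?case
    unfolding concat_replicate_Suc fold_append comp_def Suc
    using assms by (auto simp: less_Suc_eq algebra_simps)
qed simp

lemma fold_scan_item:
  assumes "length ms \<ge> 2"
  shows "fold E (scan_item m) (St a X q 0 g ms) =
     St (if g = 0 \<and> (\<forall>t<m. X (int t) = (ms ! 1) (2 * int t + 1)) then 2 else a) X q 0 g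
       (ms[1 := shift (2 * int m + 1) (ms ! 1)])"
  using assms by (auto simp: scan_item_def fold_Match fold_XLeft algebra_simps)

text \<open>Letter \<open>t\<close> of item \<open>s\<close> sits at cell s(2m+1)+2t+1. The tape
  contents are arbitrary because nothing is known about the output if \<open>x\<close> was put in a
  wrong place.\<close>

lemma fold_scan:
  assumes "length ms \<ge> 2"
  shows "fold E (concat (replicate r (scan_item m))) (St a X q 0 g ms) =
     St (if g = 0 \<and> (\<exists>s<r. \<forall>t<m. X (int t) = (ms ! 1) (int s * (2 * int m + 1) + 2 * int t + 1)) then 2 else a)
       X q 0 g (ms[1 := shift (int r * (2 * int m + 1)) (ms ! 1)])"
proof (induction r)
  case (Suc r)
  have l: "length (ms[1 := shift (int r * (2 * int m + 1)) (ms ! 1)]) \<ge> 2"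
    using assms by simp
  have e: "shift (2 * int m + 1) (shift (int r * (2 * int m + 1)) (ms ! 1)) =
      shift (int (Suc r) * (2 * int m + 1)) (ms ! 1)"
    by (simp add: algebra_simps)
  let ?hit = "\<lambda>s. \<forall>t<m. X (int t) = (ms ! 1) (int s * (2 * int m + 1) + 2 * int t + 1)"
  have h: "(\<forall>t<m. X (int t) = shift (int r * (2 * int m + 1)) (ms ! 1) (2 * int t + 1)) \<longleftrightarrow> ?hit r"
    by (simp add: shift_def algebra_simps)
  have ex: "(\<exists>s<Suc r. ?hit s) \<longleftrightarrow> (\<exists>s<r. ?hit s) \<or> ?hit r"
    by (auto simp only: less_Suc_eq)
  have n: "ms[1 := G] ! 1 = G" for G
    using assms by simp
  have i: "(if g = 0 \<and> Q then 2 else if g = 0 \<and> R then 2 else a) = (if g = 0 \<and> (R \<or> Q) then 2 else a)"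
    for Q R
    by auto
  show ?case
    unfolding concat_replicate_Suc fold_append comp_def Suc fold_scan_item[OF l] n h ex e i
      list_update_overwrite
    by (rule refl)
qed simp

subsection \<open>Cleaning up\<close>

text \<open>Distances are measured from the head, so a step widens the window by at most one cell,
  wherever the head went.\<close>

definition confined :: "nat \<Rightarrow> ctape \<Rightarrow> bool" where
  "confined u g \<longleftrightarrow> (\<forall>i. \<bar>i\<bar> > int u \<longrightarrow> g i = 0)"

lemma confined_cact: "confined u g \<Longrightarrow> confined (Suc u) (cact a g)"
  by (cases a; cases "snd a") (auto simp: confined_def)

lemma confined_shift: "confined u g \<Longrightarrow> \<bar>d\<bar> \<le> int e \<Longrightarrow> confined (u + e) (shift d g)"
  by (auto simp: confined_def shift_def)

lemma confined_mono: "confined u g \<Longrightarrow> u \<le> v \<Longrightarrow> confined v g"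
  by (auto simp: confined_def)

lemma confined_seek: "confined u g \<Longrightarrow> confined (u + j) ((seek ^^ j) g)"
proof (induction j)
  case (Suc j)
  then have "confined (u + j) ((seek ^^ j) g)"
    by simp
  moreover have "confined (Suc v) (seek h)" if "confined v h" for v h
    using that confined_shift[of v h 1 1] confined_mono[of v h "Suc v"] by (simp add: seek_def)
  ultimately show ?case
    by simp
qed simp

lemma confined_cstep:
  assumes "confined u (gs ! j)" "j < length (snd ((cstep M ^^ t) (q, gs)))"
  shows "confined (u + t) (snd ((cstep M ^^ t) (q, gs)) ! j)"
  using assms(2)
proof (induction t)
  case (Suc t)
  obtain q' gs' where c: "(cstep M ^^ t) (q, gs) = (q', gs')"
    by (cases "(cstep M ^^ t) (q, gs)")
  have j: "j < length (snd (cstep M (q', gs')))"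
    using Suc.prems c by simp
  have "j < length gs' \<and> (snd (cstep M (q', gs')) ! j = gs' ! j \<or> (\<exists>a. snd (cstep M (q', gs')) ! j = cact a (gs' ! j)))"
    using j unfolding cstep_def
    by (cases "q' < num_states M"; cases "trans M q' (map (\<lambda>g. g 0) gs')")
      (auto simp del: cact.simps split_paired_All split_paired_Ex)
  then show ?case
    using Suc.IH c confined_cact[of "u + t" "gs' ! j"] confined_mono[of "u + t" "gs' ! j" "Suc (u + t)"]
    by (auto simp del: cact.simps)
qed (use assms in simp)

lemma erase_left_funpow:
  "(erase_left ^^ j) g = (\<lambda>i. if 0 < i \<and> i \<le> int j then 0 else g (i - int j))"
  by (induction j) (auto simp: erase_left_def fun_eq_iff algebra_simps)

definition clean :: "nat \<Rightarrow> instr list" where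
  "clean u = replicate u AllRight @ replicate (Suc (2 * u)) EraseLeft"

text \<open>After \<open>u\<close> moves to the right the head is on the right end of the window of
  2u+1 cells, which the erasing moves then sweep completely.\<close>

lemma fold_clean:
  assumes "\<forall>g \<in> set ms. confined u g"
  shows "fold E (clean u) (St a X q f g ms) = St a X 0 f 0 (replicate (length ms) (\<lambda>_. 0))"
proof -
  have "(erase_left ^^ Suc (2 * u)) (shift (int u) h) = (\<lambda>_. 0)" if "h \<in> set ms" for h
    using assms that unfolding erase_left_funpow by (auto simp: shift_def confined_def fun_eq_iff)
  then have "map ((erase_left ^^ Suc (2 * u)) \<circ> shift (int u)) ms = map (\<lambda>_. \<lambda>_. 0) ms"
    by (intro map_cong) (simp_all del: funpow.simps)
  then show ?thesis
    unfolding clean_def fold_append comp_def[of "fold _ _"] fold_AllRight fold_EraseLeft map_map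
    by (simp add: map_replicate_const)
qed

subsection \<open>One query to the selector\<close>

text \<open>The summands account for the input, the simulated steps, the moves to the left, the
  search for the output and its scan.\<close>

definition query_clean_bound :: "nat \<Rightarrow> nat \<Rightarrow> nat \<Rightarrow> nat" where
  "query_clean_bound m l t = l + t + Suc t + Suc (2 * t) + Suc (2 * t) * (2 * m + 1)"

text \<open>After \<open>t\<close> simulated steps the output lies within distance \<open>t\<close> of the head, so its start is found
  by going \<open>t + 1\<close> cells to the left and then to the right up to the first nonblank cell.\<close>

definition query :: "nat \<Rightarrow> nat \<Rightarrow> str list \<Rightarrow> str list \<Rightarrow> instr list" where
  "query m t ys1 ys2 =
     (let l = length (encode_tuple ys1) + (2 * m + 1) + length (encode_tuple ys2) in
     concat (map (check ReqGreater) ys1) @ concat (map (check ReqLess) ys2) @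
     map Emit (encode_tuple ys1) @ emit_x m @ map Emit (encode_tuple ys2) @
     replicate l Rewind @ replicate t Run @
     replicate (Suc t) OutLeft @ replicate (Suc (2 * t)) OutSeek @
     concat (replicate (Suc (2 * t)) (scan_item m)) @ clean (query_clean_bound m l t))"

definition query_output :: "nat \<Rightarrow> str \<Rightarrow> ctape" where
  "query_output t w = (seek ^^ Suc (2 * t)) (shift (- int (Suc t))
     (snd ((cstep M ^^ t) (0, str_contents w # replicate (num_tapes M - 1) (\<lambda>_. 0))) ! 1))"

text \<open>This is what the scan finds on any output, malformed or not. It tries 2t+1 items because
  \<open>t\<close> steps leave at most 2t+1 letters.\<close>

definition query_hit :: "nat \<Rightarrow> str \<Rightarrow> str \<Rightarrow> bool" where
  "query_hit t w x \<longleftrightarrow> (\<exists>s<Suc (2 * t). \<forall>i<length x. str_contents x (int i) =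
     query_output t w (int s * (2 * int (length x) + 1) + 2 * int i + 1))"

lemma length_encode_item: "length (encode_item x) = 2 * length x + 1"
  by (induction x) (auto simp: encode_item_def)

lemma encode_tuple_append: "encode_tuple (xs @ ys) = encode_tuple xs @ encode_tuple ys"
  by (simp add: encode_tuple_def)

lemma encode_tuple_Cons: "encode_tuple (x # ys) = encode_item x @ encode_tuple ys"
  by (simp add: encode_tuple_def)

abbreviation home :: "symbol \<Rightarrow> str \<Rightarrow> ctape list" where
  "home a x \<equiv> St a (str_contents x) 0 0 0 (replicate (num_tapes M) (\<lambda>_. 0))"

text \<open>The phases are followed one after another. If \<open>x\<close> does not fit between
  \<open>ys1\<close> and \<open>ys2\<close>, the simulated run may be meaningless, but the guard
  keeps \<open>Hit\<close> from accepting. All but the flag is restored, so queries can be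
  concatenated.\<close>

lemma fold_query:
  assumes wf: "wf_tm M" and len: "\<forall>y \<in> set (ys1 @ ys2). length y = length x"
  shows "fold E (query (length x) t ys1 ys2) (home a x) =
    home (if (\<forall>y \<in> set ys1. lex_less y x) \<and> (\<forall>y \<in> set ys2. lex_less x y) \<and>
             query_hit t (encode_tuple (ys1 @ x # ys2)) x then 2 else a) x"
proof -
  define m where "m = length x"
  define w where "w = encode_tuple (ys1 @ x # ys2)"
  define l where "l = length (encode_tuple ys1) + (2 * m + 1) + length (encode_tuple ys2)"
  define k where "k = num_tapes M - 1"
  define X where "X = str_contents x"
  define g where "g = (if (\<forall>y \<in> set ys1. lex_less y x) \<and> (\<forall>y \<in> set ys2. lex_less x y) then 0 else 1 :: nat)"
  have k: "k \<ge> 1" "num_tapes M = Suc k"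
    using wf by (auto simp: k_def wf_tm_def)
  have lw: "length w = l"
    by (simp add: w_def l_def m_def encode_tuple_append encode_tuple_Cons length_encode_item)
  have w: "w = (encode_tuple ys1 @ encode_item x) @ encode_tuple ys2"
    by (simp add: w_def encode_tuple_append encode_tuple_Cons)
  have guard: "fold E (concat (map (check ReqLess) ys2))
      (fold E (concat (map (check ReqGreater) ys1)) (home a x)) = St a X 0 0 g (loaded k [])"
    using len by (simp add: fold_checks_less fold_checks_greater X_def g_def loaded_def k(2))
  have emit: "fold E (map Emit (encode_tuple ys2)) (fold E (emit_x m)
      (fold E (map Emit (encode_tuple ys1)) (St a X 0 0 g (loaded k [])))) = St a X 0 0 g (loaded k w)"
    unfolding X_def m_def by (simp add: fold_Emit[OF k(1)] fold_emit_x[OF k(1)] w)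
  let ?ms = "str_contents w # replicate k (\<lambda>_. 0)"
  obtain k' where k': "k = Suc k'"
    using k(1) by (cases k) auto
  have rewind: "fold E (replicate l Rewind) (St a X 0 0 g (loaded k w)) = St a X 0 0 g ?ms"
    by (simp add: loaded_def k' fold_Rewind lw)
  have sw: "str_contents u i < num_symbols M" for u i
    using wf by (auto simp: wf_tm_def str_contents_def)
  have wfc: "wf_cconfig (0, ?ms)"
    using k(2) sw[of w] sw[of "[]"] by (auto simp: wf_cconfig_def)
  obtain q ms where c: "(cstep M ^^ t) (0, ?ms) = (q, ms)"
    by (cases "(cstep M ^^ t) (0, ?ms)")
  have run: "fold E (replicate t Run) (St a X 0 0 g ?ms) = St a X q 0 g ms"
    by (simp add: fold_Run[OF wf wfc] c)
  have "wf_cconfig ((cstep M ^^ t) (0, ?ms))"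
    by (induction t) (auto intro: wf_cconfig_cstep[OF wf] wfc)
  then have lms: "length ms = Suc k" "length ms \<ge> 2"
    using k by (auto simp: wf_cconfig_def c)
  have "confined l h" if "h \<in> set ?ms" for h
    using that by (auto simp: confined_def str_contents_def lw)
  then have "confined l (?ms ! j)" if "j < Suc k" for j
    using that nth_mem[of j ?ms] by simp
  then have win: "\<forall>h \<in> set ms. confined (l + t) h"
    using confined_cstep[of l ?ms _ t 0] c lms(1) by (auto simp: in_set_conv_nth)
  define G where "G = query_output t w"
  have G: "G = (seek ^^ Suc (2 * t)) (shift (- int (Suc t)) (ms ! 1))"
    unfolding G_def query_output_def k_def[symmetric] c snd_conv ..
  have pos: "fold E (replicate (Suc (2 * t)) OutSeek) (fold E (replicate (Suc t) OutLeft)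
      (St a X q 0 g ms)) = St a X q 0 g (ms[1 := G])"
    using lms by (simp add: fold_OutLeft fold_OutSeek G del: funpow.simps replicate.simps)
  let ?hit = "\<exists>s<Suc (2 * t). \<forall>i<m. X (int i) = G (int s * (2 * int m + 1) + 2 * int i + 1)"
  let ?a = "if g = 0 \<and> ?hit then 2 else a"
  define ms' where "ms' = ms[1 := shift (int (Suc (2 * t)) * (2 * int m + 1)) G]"
  have scan: "fold E (concat (replicate (Suc (2 * t)) (scan_item m))) (St a X q 0 g (ms[1 := G])) =
      St ?a X q 0 g ms'"
    using lms by (subst fold_scan) (simp_all add: ms'_def del: replicate.simps)
  have "confined (l + t) (ms ! 1)"
    using win lms by (simp add: nth_mem)
  then have "confined (l + t + Suc t) (shift (- int (Suc t)) (ms ! 1))"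
    by (rule confined_shift) simp
  then have "confined (l + t + Suc t + Suc (2 * t)) G"
    unfolding G by (rule confined_seek)
  then have "confined (query_clean_bound m l t) (shift (int (Suc (2 * t)) * (2 * int m + 1)) G)"
    unfolding query_clean_bound_def by (rule confined_shift) (simp add: algebra_simps)
  moreover have "\<forall>h \<in> set ms. confined (query_clean_bound m l t) h"
    using win by (auto simp: query_clean_bound_def intro: confined_mono)
  ultimately have "\<forall>h \<in> set ms'. confined (query_clean_bound m l t) h"
    using set_update_subset_insert[of ms 1] unfolding ms'_def by blast
  then have cl: "fold E (clean (query_clean_bound m l t)) (St ?a X q 0 g ms') = home ?a x"
    using fold_clean lms k by (simp add: ms'_def X_def)
  have "fold E (query m t ys1 ys2) (home a x) = home ?a x"
    unfolding query_def Let_def l_def[symmetric] fold_append comp_def guard emit rewind run pos scan cl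
    by (rule refl)
  moreover have "?a = (if (\<forall>y \<in> set ys1. lex_less y x) \<and> (\<forall>y \<in> set ys2. lex_less x y) \<and> query_hit t w x then 2 else a)"
  proof -
    have "?hit \<longleftrightarrow> query_hit t w x"
      unfolding query_hit_def G_def m_def X_def ..
    then show ?thesis
      by (simp add: g_def)
  qed
  ultimately show ?thesis
    by (simp add: m_def w_def)
qed

subsection \<open>Reading off the answer\<close>

lemma str_contents_append: "str_contents (u @ v) (int (length u) + int i) = str_contents v (int i)"
  by (simp add: str_contents_def nth_append nat_add_distrib)

lemma str_contents_append_left: "i < length u \<Longrightarrow> str_contents (u @ v) (int i) = str_contents u (int i)"
  by (simp add: str_contents_def nth_append)

lemma str_contents_doubled:
  "i < length y \<Longrightarrow> str_contents (encode_item y) (2 * int i + 1) = str_contents y (int i)"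
proof (induction y arbitrary: i)
  case (Cons b y)
  show ?case
  proof (cases i)
    case 0
    then show ?thesis by (simp add: encode_item_def str_contents_def)
  next
    case (Suc j)
    have e: "encode_item (b # y) = [True, b] @ encode_item y"
      by (simp add: encode_item_def)
    have "str_contents (encode_item (b # y)) (2 * int i + 1) = str_contents (encode_item y) (int (2 * j + 1))"
      using str_contents_append[of "[True, b]" "encode_item y" "2 * j + 1"] by (simp add: e Suc)
    also have "\<dots> = str_contents y (int j)"
      using Cons.IH[of j] Cons.prems Suc by (simp add: algebra_simps)
    also have "\<dots> = str_contents (b # y) (int i)"
      using str_contents_append[of "[b]" y j] by (simp add: Suc)
    finally show ?thesis .
  qed
qed simp

text \<open>Items of equal length form blocks of 2m+1 cells; the 0 is the blank beyond the last
  block.\<close>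

lemma str_contents_encode_tuple:
  assumes "\<forall>z \<in> set zs. length z = m" "i < m"
  shows "str_contents (encode_tuple zs) (int s * (2 * int m + 1) + 2 * int i + 1) =
    (if s < length zs then str_contents (zs ! s) (int i) else 0)"
  using assms(1)
proof (induction zs arbitrary: s)
  case Nil
  then show ?case by (simp add: encode_tuple_def)
next
  case (Cons z zs)
  have lz: "length (encode_item z) = 2 * m + 1"
    using Cons.prems by (simp add: length_encode_item)
  show ?case
  proof (cases s)
    case 0
    then show ?thesis
      using str_contents_append_left[of "2 * i + 1" "encode_item z" "encode_tuple zs"] lz assms(2)
        str_contents_doubled[of i z] Cons.prems
      by (simp add: encode_tuple_Cons add.commute[of 1])
  next
    case (Suc r)
    have e: "int s * (2 * int m + 1) + 2 * int i + 1 =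
        int (length (encode_item z)) + int (r * (2 * m + 1) + 2 * i + 1)"
      by (simp add: lz Suc algebra_simps)
    have "str_contents (encode_tuple (z # zs)) (int s * (2 * int m + 1) + 2 * int i + 1) =
        str_contents (encode_tuple zs) (int (r * (2 * m + 1) + 2 * i + 1))"
      unfolding e encode_tuple_Cons str_contents_append ..
    also have "\<dots> = str_contents (encode_tuple zs) (int r * (2 * int m + 1) + 2 * int i + 1)"
      by (simp add: algebra_simps)
    finally show ?thesis
      using Cons.IH[of r] Cons.prems Suc by simp
  qed
qed

lemma str_contents_eq_iff:
  assumes "length x = length y"
  shows "(\<forall>i<length x. str_contents x (int i) = str_contents y (int i)) \<longleftrightarrow> x = y"
  using assms by (auto simp: str_contents_def list_eq_iff_nth_eq split: if_splits)

text \<open>Once a nonblank cell is scanned, further seeks do nothing, so every number of seeks from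
  \<open>d\<close> on has the same effect.\<close>

lemma seek_reaches:
  assumes "\<forall>i. 0 \<le> i \<and> i < int d \<longrightarrow> g i = 0" "g (int d) \<noteq> 0" "d \<le> j"
  shows "(seek ^^ j) g = shift (int d) g"
  using assms
proof (induction j arbitrary: d g)
  case (Suc j)
  show ?case
  proof (cases d)
    case 0
    then have "seek g = g"
      using Suc.prems by (simp add: seek_def)
    then show ?thesis
      using Suc.IH[of 0 g] Suc.prems 0 by (simp add: funpow_swap1)
  next
    case (Suc e)
    then have "seek g = shift 1 g"
      using Suc.prems by (simp add: seek_def)
    moreover have "(seek ^^ j) (shift 1 g) = shift (int e) (shift 1 g)"
      by (rule Suc.IH) (use Suc.prems Suc in \<open>auto simp: shift_def algebra_simps\<close>)
    ultimately show ?thesis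
      using Suc by (simp add: funpow_swap1 algebra_simps)
  qed
qed simp

lemma halted_stays: "(step M ^^ t) (num_states M, ts) = (num_states M, ts)"
  by (induction t) auto

text \<open>The output tape starts blank, so after \<open>t\<close> steps its nonblank cells are
  within distance \<open>t\<close> of the head. The first and the last letter of the nonempty
  \<open>y\<close> are such cells, which bounds both the search and the length by 2t+1.\<close>

lemma query_output_eq:
  assumes "wf_tm M" "computes_within M w y t" "y \<noteq> []"
  shows "query_output t w = str_contents y" "length y \<le> Suc (2 * t)"
proof -
  obtain t' ts where t': "t' \<le> t" "(step M ^^ t') (init_config M w) = (num_states M, ts)"
    "fst (ts ! 1) = str_contents y"
    using assms(2) by (auto simp: computes_within_def)
  \<comment> \<open>The run is prolonged to exactly \<open>t\<close> steps; a halted machine stays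
    as it is.\<close>
  have "(step M ^^ t) (init_config M w) = (step M ^^ (t - t')) ((step M ^^ t') (init_config M w))"
    using t'(1) by (simp flip: funpow_add comp_apply[of "_ ^^ _" "_ ^^ _"])
  then have r: "(step M ^^ t) (init_config M w) = (num_states M, ts)"
    using t'(2) halted_stays by simp
  let ?ms = "str_contents w # replicate (num_tapes M - 1) (\<lambda>_. 0)"
  have i: "init_config M w = (0, (str_contents w, 0) # replicate (num_tapes M - 1) (\<lambda>_. 0, 0))"
    by (simp add: init_config_def)
  have c: "(cstep M ^^ t) (0, ?ms) = (num_states M, map centre ts)"
    using cstep_funpow_centre[where M = M and t = t and q = 0 and
        ts = "(str_contents w, 0) # replicate (num_tapes M - 1) (\<lambda>_. 0, 0)"] r
    by (simp add: i)
  have lts: "1 < length ts"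
  proof -
    have "wf_cconfig ((cstep M ^^ t) (0, ?ms))"
    proof (induction t)
      case 0
      have "str_contents u i < num_symbols M" for u i
        using assms(1) by (auto simp: wf_tm_def str_contents_def)
      from this[of w] this[of "[]"] show ?case
        using assms(1) by (auto simp: wf_cconfig_def wf_tm_def)
    qed (auto intro: wf_cconfig_cstep[OF assms(1)])
    then show ?thesis
      using assms(1) unfolding c wf_cconfig_def by (simp add: wf_tm_def)
  qed
  define h where "h = snd (ts ! 1)"
  have o: "centre (ts ! 1) = shift h (str_contents y)"
    using t'(3) by (cases "ts ! 1") (simp add: h_def shift_def)
  have "confined 0 (?ms ! 1)"
    using assms(1) by (simp add: confined_def wf_tm_def)
  then have "confined t (centre (ts ! 1))"
    using confined_cstep[of 0 ?ms 1 t 0, unfolded c snd_conv] lts by simp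
  then have win: "str_contents y (i + h) = 0" if "\<bar>i\<bar> > int t" for i
    using that unfolding o by (simp add: confined_def shift_def)
  have ne: "str_contents y 0 \<noteq> 0" "str_contents y (int (length y) - 1) \<noteq> 0"
    using assms(3) by (auto simp: str_contents_def)
  have h: "\<bar>h\<bar> \<le> int t" "\<bar>int (length y) - 1 - h\<bar> \<le> int t"
    using win[of "-h"] win[of "int (length y) - 1 - h"] ne by force+
  then show "length y \<le> Suc (2 * t)"
    by linarith
  \<comment> \<open>The head is at cell \<open>h\<close> and \<open>y\<close> starts at cell 0, so
    the search starts at cell h-(t+1), which is t+1-h cells before \<open>y\<close>.\<close>
  define d where "d = nat (int (Suc t) - h)"
  have d: "int d = int (Suc t) - h" "d \<le> Suc (2 * t)"
    using h by (auto simp: d_def)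
  have "query_output t w = (seek ^^ Suc (2 * t)) (shift (- int (Suc t)) (shift h (str_contents y)))"
    unfolding query_output_def c snd_conv o[symmetric] using lts by simp
  also have "\<dots> = shift (int d) (shift (- int (Suc t)) (shift h (str_contents y)))"
  proof (rule seek_reaches)
    show "\<forall>i. 0 \<le> i \<and> i < int d \<longrightarrow> shift (- int (Suc t)) (shift h (str_contents y)) i = 0"
      unfolding d(1) by (auto simp: shift_def str_contents_def)
  qed (use d ne in \<open>auto simp: shift_def\<close>)
  also have "\<dots> = str_contents y"
    by (simp add: d(1))
  finally show "query_output t w = str_contents y" .
qed

lemma query_hit_iff:
  assumes "wf_tm M" "computes_within M w (encode_tuple zs) t" "zs \<noteq> []"
    "\<forall>z \<in> set zs. length z = length x" "x \<noteq> []"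
  shows "query_hit t w x \<longleftrightarrow> x \<in> set zs"
proof -
  have "encode_tuple zs \<noteq> []"
    using assms(3) by (cases zs) (auto simp: encode_tuple_def encode_item_def)
  note o = query_output_eq[OF assms(1,2) this]
  have "length zs \<le> length (encode_tuple zs)"
    by (induction zs) (auto simp: encode_tuple_def encode_item_def)
  with o(2) have l: "length zs \<le> Suc (2 * t)"
    by simp
  have "(\<forall>i<length x. str_contents x (int i) = query_output t w (int s * (2 * int (length x) + 1) + 2 * int i + 1))
      \<longleftrightarrow> s < length zs \<and> x = zs ! s" for s
  proof (cases "s < length zs")
    case True
    then show ?thesis
      using assms(4) str_contents_encode_tuple[OF assms(4)] str_contents_eq_iff[of x "zs ! s"]
      by (simp add: o(1))
  next
    case False
    \<comment> \<open>Beyond the last item the tape is blank, whereas the nonempty \<open>x\<close>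
      has a first letter to compare.\<close>
    moreover have "str_contents x (int 0) \<noteq> 0"
      using assms(5) by (simp add: str_contents_def)
    ultimately show ?thesis
      using str_contents_encode_tuple[OF assms(4), of 0 s] assms(5) by (auto simp: o(1))
  qed
  then have "query_hit t w x \<longleftrightarrow> (\<exists>s<Suc (2 * t). s < length zs \<and> x = zs ! s)"
    by (simp add: query_hit_def)
  also have "\<dots> \<longleftrightarrow> x \<in> set zs"
    using l by (metis in_set_conv_nth less_le_trans)
  finally show ?thesis .
qed

end

section \<open>A small family of winners\<close>

text \<open>Double counting: every \<open>n\<close>-subset of \<open>C\<close> arises by adding to
  some \<open>S\<close> of size n-1 an element \<open>y\<close> that is then selected. Were there
  always fewer than (|C|-n+1)/n such \<open>y\<close>, the number of \<open>n\<close>-subsets would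
  be less than (|C|-n+1)/n times the number of sets \<open>S\<close>, but these two numbers are
  equal.\<close>

lemma popular_subset:
  fixes sel :: "'a set \<Rightarrow> 'a set"
  assumes fin: "finite C" and n: "1 \<le> n" "n \<le> card C"
    and sel: "\<And>T. T \<subseteq> C \<Longrightarrow> card T = n \<Longrightarrow> sel T \<noteq> {} \<and> sel T \<subseteq> T"
  shows "\<exists>S \<subseteq> C. card S = n - 1 \<and> card C - (n - 1) \<le> n * card {y \<in> C - S. y \<in> sel (insert y S)}"
proof (rule ccontr)
  assume neg: "\<not> ?thesis"
  define B where "B = (\<lambda>S. {y \<in> C - S. y \<in> sel (insert y S)})"
  define F where "F = {T. T \<subseteq> C \<and> card T = n}"
  define G where "G = {S. S \<subseteq> C \<and> card S = n - 1}"
  have lt: "n * card (B S) < card C - (n - 1)" if "S \<in> G" for S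
    using neg that by (force simp: B_def G_def)
  have cards: "card F = card C choose n" "card G = card C choose (n - 1)"
    unfolding F_def G_def by (rule n_subsets[OF fin])+
  have fG: "finite G" "finite (B S)" for S
    using fin by (auto simp: G_def B_def)
  have "F \<subseteq> (\<Union>S\<in>G. (\<lambda>y. insert y S) ` B S)"
  proof
    fix T
    assume T: "T \<in> F"
    then obtain y where y: "y \<in> sel T" "y \<in> T"
      using sel[of T] by (auto simp: F_def)
    have "finite T"
      using T fin by (auto simp: F_def intro: finite_subset)
    then have "T - {y} \<in> G" "y \<in> B (T - {y})" "insert y (T - {y}) = T"
      using T y by (auto simp: F_def G_def B_def insert_absorb)
    then show "T \<in> (\<Union>S\<in>G. (\<lambda>y. insert y S) ` B S)"
      by (intro UN_I[of "T - {y}"] image_eqI[of _ _ y]) simp_all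
  qed
  then have "card F \<le> card (\<Union>S\<in>G. (\<lambda>y. insert y S) ` B S)"
    using fG by (intro card_mono) auto
  also have "\<dots> \<le> (\<Sum>S\<in>G. card ((\<lambda>y. insert y S) ` B S))"
    using fG by (intro card_UN_le)
  also have "\<dots> \<le> (\<Sum>S\<in>G. card (B S))"
    using fG by (intro sum_mono card_image_le)
  finally have "n * card F \<le> (\<Sum>S\<in>G. n * card (B S))"
    by (simp flip: sum_distrib_left)
  also have "\<dots> < (\<Sum>S\<in>G. card C - (n - 1))"
  proof (rule sum_strict_mono)
    have "card G > 0"
      using n by (simp add: cards)
    then show "G \<noteq> {}"
      by auto
  qed (use fG lt in auto)
  also have "\<dots> = (card C - (n - 1)) * (card C choose (n - 1))"
    by (simp add: cards)
  also have "\<dots> = card C * ((card C - 1) choose (n - 1))"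
    by (rule binomial_absorb_comp)
  also have "\<dots> = n * (card C choose n)"
    using times_binomial_minus1_eq[of n "card C"] n by simp
  finally show False
    by (simp add: cards)
qed

text \<open>Greedy induction: removing a popular \<open>S\<close> and its winners leaves at most a
  fraction 1-1/n of \<open>C\<close>, which lowers \<open>r\<close> by one in \<open>small\<close>.
  The elements of \<open>S\<close> itself go into \<open>D\<close>, and so does everything once
  fewer than \<open>n\<close> elements remain. For \<open>r = 0\<close> the hypothesis
  \<open>small\<close> forces \<open>C\<close> to be empty.\<close>

lemma winners_cover:
  fixes sel :: "'a set \<Rightarrow> 'a set"
  assumes n: "1 \<le> n" and fin: "finite C"
    and sel: "\<And>T. T \<subseteq> C \<Longrightarrow> card T = n \<Longrightarrow> sel T \<noteq> {} \<and> sel T \<subseteq> T"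
    and small: "card C * (n - 1) ^ r < n ^ r"
  shows "\<exists>Ss D. length Ss \<le> r \<and> D \<subseteq> C \<and> card D \<le> n * r \<and> (\<forall>S \<in> set Ss. S \<subseteq> C \<and> card S = n - 1) \<and>
     (\<forall>x \<in> C. x \<in> D \<or> (\<exists>S \<in> set Ss. x \<notin> S \<and> x \<in> sel (insert x S)))"
  using fin sel small
proof (induction r arbitrary: C)
  case 0
  then show ?case by auto
next
  case (Suc r)
  show ?case
  proof (cases "card C < n")
    case True
    then show ?thesis
      by (intro exI[of _ "[]"] exI[of _ C]) (auto intro: le_trans[of _ n])
  next
    case False
    then have "n \<le> card C"
      by simp
    from popular_subset[where sel = sel, OF Suc.prems(1) n this] Suc.prems(2)
    obtain S where S: "S \<subseteq> C" "card S = n - 1"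
        "card C - (n - 1) \<le> n * card {y \<in> C - S. y \<in> sel (insert y S)}"
      by blast
    define B where "B = {y \<in> C - S. y \<in> sel (insert y S)}"
    define C' where "C' = C - S - B"
    have C': "C' \<subseteq> C" "finite C'"
      using Suc.prems(1) by (auto simp: C'_def)
    have "card (C - S) = card C - (n - 1)"
      using S Suc.prems(1) by (simp add: card_Diff_subset finite_subset)
    moreover have "card C' = card (C - S) - card B"
      unfolding C'_def using Suc.prems(1) by (intro card_Diff_subset) (auto simp: B_def)
    moreover have "card B \<le> card (C - S)"
      using Suc.prems(1) by (intro card_mono) (auto simp: B_def)
    moreover define e where "e = card C - (n - 1)"
    ultimately have e: "card C' = e - card B" "e \<le> n * card B" "card C = (n - 1) + e" "card B \<le> e"
      using S(3) False n by (auto simp: B_def)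
    \<comment> \<open>From e <= n|B| and e <= |C| it will follow that n|C'| <= (n-1)|C|.\<close>
    have "n * card C' + n * card B = n * e"
      unfolding e(1) using e(4) by (simp flip: add_mult_distrib2)
    also have "\<dots> = (n - 1) * e + e"
      using n by (cases n) auto
    also have "\<dots> \<le> (n - 1) * card C + n * card B"
      unfolding e(3) by (intro add_mono mult_left_mono e(2)) auto
    finally have "n * card C' \<le> (n - 1) * card C"
      by simp
    then have "n * card C' * (n - 1) ^ r \<le> (n - 1) * card C * (n - 1) ^ r"
      by (rule mult_right_mono) simp
    also have "\<dots> < n ^ Suc r"
      using Suc.prems(3) by (simp add: ac_simps)
    finally have "n * (card C' * (n - 1) ^ r) < n * n ^ r"
      by (simp add: ac_simps)
    then have "card C' * (n - 1) ^ r < n ^ r"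
      by simp
    moreover have sel': "sel T \<noteq> {} \<and> sel T \<subseteq> T" if "T \<subseteq> C'" "card T = n" for T
      using Suc.prems(2)[of T] that C'(1) by blast
    ultimately obtain Ss D where IH: "length Ss \<le> r" "D \<subseteq> C'" "card D \<le> n * r"
        "\<forall>S \<in> set Ss. S \<subseteq> C' \<and> card S = n - 1"
        "\<forall>x \<in> C'. x \<in> D \<or> (\<exists>S \<in> set Ss. x \<notin> S \<and> x \<in> sel (insert x S))"
      using Suc.IH[OF C'(2) sel'] by auto
    have "card (S \<union> D) \<le> n * Suc r"
      using card_Un_le[of S D] S(2) IH(3) by simp
    moreover have "x \<in> S \<union> D \<or> (\<exists>S' \<in> set (S # Ss). x \<notin> S' \<and> x \<in> sel (insert x S'))" if "x \<in> C" for x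
      using that IH(5) by (auto simp: C'_def B_def)
    moreover have "\<forall>S' \<in> set (S # Ss). S' \<subseteq> C \<and> card S' = n - 1"
      using IH(4) S(1,2) C'(1) by auto
    ultimately show ?thesis
      using IH(1,2) S(1) C'(1) by (intro exI[of _ "S # Ss"] exI[of _ "S \<union> D"]) auto
  qed
qed

text \<open>This is (1-1/n)^n <= 1/2. With k = n-1, the first two terms of the binomial expansion of
  (k+1)^n are k^n + n k^(n-1), which is at least 2 k^n.\<close>

lemma two_mult_pred_power_le:
  fixes n :: nat
  assumes "1 \<le> n"
  shows "2 * (n - 1) ^ n \<le> n ^ n"
proof (cases "n = 1")
  case False
  define k where "k = n - 1"
  have k: "n = Suc k" "k \<ge> 1"
    using assms False by (auto simp: k_def)
  have "(n - 1) ^ n + n * (n - 1) ^ (n - 1) \<le> n ^ n"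
  proof -
    have "k ^ j + j * k ^ (j - 1) \<le> Suc k ^ j" for j
    proof (induction j)
      case (Suc j)
      define a where "a = j * k ^ (j - 1)"
      have "a * k = j * k ^ j"
        by (cases j) (simp_all add: a_def algebra_simps)
      then have "k ^ Suc j + Suc j * k ^ j \<le> (k ^ j + a) * Suc k"
        by (simp add: algebra_simps)
      also have "\<dots> \<le> Suc k ^ j * Suc k"
        unfolding a_def by (rule mult_right_mono[OF Suc]) simp
      also have "\<dots> = Suc k ^ Suc j"
        by (rule power_Suc2[symmetric])
      finally show ?case by (simp only: diff_Suc_1)
    qed simp
    from this[of n] show ?thesis by (simp add: k)
  qed
  moreover have "(n - 1) ^ n \<le> n * (n - 1) ^ (n - 1)"
    by (simp add: k)
  ultimately show ?thesis by simp
qed simp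

text \<open>By the preceding bound \<open>n\<close> rounds at least halve the candidates, so n(m+1)
  rounds bring at most 2^m of them below one. For \<open>n = 1\<close> the left side is 0.\<close>

lemma rounds_suffice:
  fixes n :: nat
  assumes "1 \<le> n" "c \<le> 2 ^ m"
  shows "c * (n - 1) ^ (n * (m + 1)) < n ^ (n * (m + 1))"
proof (cases "n = 1")
  case False
  have "c * (n - 1) ^ (n * (m + 1)) \<le> 2 ^ m * (n - 1) ^ (n * (m + 1))"
    using assms(2) by simp
  also have "\<dots> < 2 ^ (m + 1) * (n - 1) ^ (n * (m + 1))"
    using False assms(1) by simp
  also have "\<dots> = (2 * (n - 1) ^ n) ^ (m + 1)"
    by (simp only: power_mult power_mult_distrib)
  also have "\<dots> \<le> (n ^ n) ^ (m + 1)"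
    by (intro power_mono two_mult_pred_power_le assms(1)) simp
  finally show ?thesis
    by (simp only: power_mult)
qed simp

section \<open>Sorted tuples\<close>

lemma sorted_insert_ex:
  assumes "sorted_wrt lex_less ys" "x \<notin> set ys"
  shows "\<exists>ys1 ys2. ys = ys1 @ ys2 \<and> sorted_wrt lex_less (ys1 @ x # ys2)"
  using assms
proof (induction ys)
  case (Cons y ys)
  show ?case
  proof (cases "lex_less x y")
    case True
    then show ?thesis
      using Cons.prems by (intro exI[of _ "[]"] exI[of _ "y # ys"]) (auto intro: lex_less_trans)
  next
    case False
    then have "lex_less y x"
      using Cons.prems lex_less_linear[of x y] by auto
    moreover obtain ys1 ys2 where "ys = ys1 @ ys2" "sorted_wrt lex_less (ys1 @ x # ys2)"
      using Cons by auto
    ultimately show ?thesis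
      using Cons.prems by (intro exI[of _ "y # ys1"] exI[of _ ys2]) auto
  qed
qed simp

lemma sorted_list_ex: "finite T \<Longrightarrow> \<exists>ys. set ys = T \<and> sorted_wrt lex_less ys"
proof (induction T rule: finite_induct)
  case (insert x T)
  then obtain ys where "set ys = T" "sorted_wrt lex_less ys"
    by blast
  then show ?case
    using sorted_insert_ex[of ys x] insert.hyps by force
qed simp

lemma sorted_distinct: "sorted_wrt lex_less ys \<Longrightarrow> distinct ys"
  by (induction ys) (auto simp: lex_less_irrefl)

text \<open>This allows a selector on sorted tuples to be treated as a function on finite
  sets.\<close>

lemma sorted_unique:
  assumes "sorted_wrt lex_less ys" "sorted_wrt lex_less zs" "set ys = set zs"
  shows "ys = zs"
  using assms
proof (induction ys arbitrary: zs)
  case (Cons y ys)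
  then obtain z zs' where zs: "zs = z # zs'"
    by (cases zs) auto
  have "y = z"
    using Cons.prems lex_less_asym unfolding zs by (metis set_ConsD list.set_intros(1) sorted_wrt.simps(2))
  moreover have "y \<notin> set ys" "z \<notin> set zs'"
    using Cons.prems by (auto simp: zs lex_less_irrefl)
  ultimately have "set ys = set zs'"
    using Cons.prems(3) by (auto simp: zs)
  then show ?case
    using Cons.IH[of zs'] Cons.prems \<open>y = z\<close> by (simp add: zs)
qed simp

section \<open>Polynomial bounds\<close>

definition polyf :: "(nat \<Rightarrow> nat) \<Rightarrow> bool" where
  "polyf g \<longleftrightarrow> (\<exists>q :: nat poly. \<forall>m. g m = poly q m)"

lemma polyf_const: "polyf (\<lambda>_. c)"
  unfolding polyf_def by (intro exI[of _ "[:c:]"]) simp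

lemma polyf_id: "polyf (\<lambda>m. m)"
  unfolding polyf_def by (intro exI[of _ "[:0, 1:]"]) simp

lemma polyf_add: "polyf g \<Longrightarrow> polyf h \<Longrightarrow> polyf (\<lambda>m. g m + h m)"
  unfolding polyf_def by (metis poly_add)

lemma polyf_mult: "polyf g \<Longrightarrow> polyf h \<Longrightarrow> polyf (\<lambda>m. g m * h m)"
  unfolding polyf_def by (metis poly_mult)

lemma polyf_poly: "polyf g \<Longrightarrow> polyf (\<lambda>m. poly p (g m))"
  unfolding polyf_def by (metis poly_pcompose)

lemmas polyf_intros = polyf_const polyf_id polyf_add polyf_mult polyf_poly

lemma length_encode_tuple:
  "\<forall>y \<in> set ys. length y = m \<Longrightarrow> length (encode_tuple ys) = length ys * (2 * m + 1)"
  by (induction ys) (auto simp: encode_tuple_def length_encode_item)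

lemma length_concat_le: "\<forall>x \<in> set xs. length (f x) \<le> b \<Longrightarrow> length (concat (map f xs)) \<le> length xs * b"
  by (induction xs) auto

text \<open>Here \<open>l\<close> is the length of the encoded tuple. \<open>3 * l + m\<close>
  covers guarding, writing and rewinding; simulation, search and scan follow, and the last line is
  the cost of cleaning.\<close>

definition query_bound :: "nat \<Rightarrow> nat \<Rightarrow> nat" where
  "query_bound m t = (let l = m * (2 * m + 1) in
     3 * l + m + t + (t + 1) + (2 * t + 1) + (2 * t + 1) * (3 * m + 2) +
     3 * (l + t + (t + 1) + (2 * t + 1) + (2 * t + 1) * (2 * m + 1)) + 1)"

lemma length_query:
  assumes "\<forall>y \<in> set (ys1 @ ys2). length y = m" "length (ys1 @ ys2) = m - 1" "m \<ge> 1"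
  shows "length (query m t ys1 ys2) \<le> query_bound m t"
proof -
  have ck: "length (check r y) = 2 * length y + 1" for r y
    by (simp add: check_def)
  define u1 u2 l where "u1 = length ys1 * (2 * m + 1)" "u2 = length ys2 * (2 * m + 1)" "l = m * (2 * m + 1)"
  note u = this
  have g: "length (concat (map (check ReqGreater) ys1)) \<le> u1" "length (concat (map (check ReqLess) ys2)) \<le> u2"
    using assms(1) unfolding u by (intro length_concat_le; simp add: ck)+
  have e: "length (encode_tuple ys1) = u1" "length (encode_tuple ys2) = u2"
    using assms(1) length_encode_tuple[of ys1 m] length_encode_tuple[of ys2 m] by (simp_all add: u)
  have n: "u1 + (2 * m + 1) + u2 = l"
  proof -
    have "m = length ys1 + 1 + length ys2"
      using assms(2,3) by simp
    then have "l = (length ys1 + 1 + length ys2) * (2 * m + 1)"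
      by (simp only: u)
    then show ?thesis
      by (simp only: u add_mult_distrib mult_1)
  qed
  have c: "length (concat (replicate j (xs :: instr list))) = j * length xs" for j xs
    by (induction j) auto
  have "length (emit_x m) = 3 * m + 1"
    by (simp add: emit_x_def c del: replicate.simps)
  moreover have "length (scan_item m) = 3 * m + 2"
    by (simp add: scan_item_def c del: replicate.simps)
  moreover have "length (clean u) = 3 * u + 1" for u
    by (simp add: clean_def del: replicate.simps)
  ultimately show ?thesis
    unfolding query_def query_bound_def query_clean_bound_def Let_def length_append length_map
      length_replicate c e n u(3)[symmetric]
    using g n by simp
qed

section \<open>The advice\<close>

lemma length_strings_finite: "finite {x :: str. length x = m}" "card {x :: str. length x = m} = 2 ^ m"
  using finite_lists_length_eq[of "UNIV :: bool set" m] card_lists_length_eq[of "UNIV :: bool set" m]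
  by (simp_all add: card_UNIV_bool)

text \<open>The 1 is for the program at length 0, the \<open>m\<close> for returning the head on
  \<open>x\<close>. With r = m(m+1) rounds there are at most mr listed strings and rm queries, as
  each round tries \<open>m\<close> positions.\<close>

definition advice_bound :: "nat poly \<Rightarrow> nat \<Rightarrow> nat" where
  "advice_bound p m = 1 + m + m * (m * (m + 1)) * (2 * m + 1) +
     m * (m + 1) * m * query_bound m (poly p (m * (2 * m + 1)))"

lemma polyf_advice_bound: "polyf (advice_bound p)"
  unfolding advice_bound_def query_bound_def Let_def by (intro polyf_intros)

lemma init_tapes_St:
  "init_tapes (num_tapes M + 5) x =
     St 0 (shift (int (length x)) (str_contents x)) 0 0 0 (replicate (num_tapes M) (\<lambda>_. 0))"
proof -
  have "reg 0 = (\<lambda>_. 0)"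
    by (auto simp: reg_def)
  then show ?thesis
    by (simp add: init_tapes_def St_def numeral_eq_Suc)
qed

lemma hd_St_0 [simp]: "hd (St a X q f g ms) 0 = a"
  by (simp add: St_def reg_def)

lemma fold_queries:
  assumes "wf_tm M" "\<forall>(ys1, ys2) \<in> set ps. \<forall>y \<in> set (ys1 @ ys2). length y = length x"
  shows "fold (exec (delta M)) (concat (map (\<lambda>(ys1, ys2). query (length x) t ys1 ys2) ps)) (home M a x) =
    home M (if \<exists>(ys1, ys2) \<in> set ps. (\<forall>y \<in> set ys1. lex_less y x) \<and> (\<forall>y \<in> set ys2. lex_less x y) \<and>
             query_hit M t (encode_tuple (ys1 @ x # ys2)) x then 2 else a) x"
    (is "fold ?E (concat (map ?Q ps)) _ = home M (if \<exists>p \<in> set ps. ?H p then 2 else a) x")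
  using assms(2)
proof (induction ps arbitrary: a)
  case (Cons p ps)
  obtain ys1 ys2 where p: "p = (ys1, ys2)"
    by (cases p)
  have "\<forall>y \<in> set (ys1 @ ys2). length y = length x"
    using Cons.prems by (simp add: p)
  from fold_query[OF assms(1) this, of t a]
  have q: "fold ?E (?Q p) (home M a x) = home M (if ?H p then 2 else a) x"
    by (simp add: p)
  have IH: "fold ?E (concat (map ?Q ps)) (home M b x) = home M (if \<exists>p \<in> set ps. ?H p then 2 else b) x" for b
    using Cons by simp
  show ?case
    unfolding list.map concat.simps fold_append comp_def q IH by simp
qed simp

lemma advice_program_ex:
  assumes L: "L \<in> Fair_S (\<lambda>n. n - 1) (\<lambda>n. 1)"
  shows "\<exists>M p. wf_tm M \<and> (\<forall>m. \<exists>is. length is \<le> advice_bound p m \<and> (\<forall>x. length x = m \<longrightarrow>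
       (x \<in> L \<longleftrightarrow> hd (fold (exec (delta M)) is (init_tapes (num_tapes M + 5) x)) 0 = 2)))"
proof -
  from L obtain f where f: "f \<in> FP" and F: "\<forall>n \<ge> 1. \<forall>ys.
     length ys = n \<and> distinct ys \<and> sorted_wrt lex_less ys \<and> (\<forall>y \<in> set ys. length y \<le> n) \<longrightarrow>
     (\<exists>zs. f (encode_tuple ys) = encode_tuple zs \<and> set zs \<subseteq> set ys \<and>
        (card (L \<inter> set ys) \<ge> n - 1 \<longrightarrow> set zs \<subseteq> L \<and> card (set zs) \<ge> 1))"
    unfolding Fair_S_def mem_Collect_eq by (elim bexE)
  obtain M p where M: "wf_tm M" "\<And>w. computes_within M w (f w) (poly p (length w))"
    using f unfolding FP_def by blast
  let ?E = "exec (delta M)"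
  have "\<exists>is. length is \<le> advice_bound p m \<and> (\<forall>x. length x = m \<longrightarrow>
       (x \<in> L \<longleftrightarrow> hd (fold ?E is (init_tapes (num_tapes M + 5) x)) 0 = 2))" for m
  proof (cases "m = 0")
    \<comment> \<open>Fairness says nothing about \<open>n = 0\<close>, so the advice itself decides
      the empty word: \<open>Hit\<close> accepts at once since both registers are 0.\<close>
    case True
    have "hd (fold ?E (if [] \<in> L then [Hit] else []) (init_tapes (num_tapes M + 5) [])) 0 = 2 \<longleftrightarrow> [] \<in> L"
      by (simp add: init_tapes_St exec_instr)
    then show ?thesis
      using True by (intro exI[of _ "if [] \<in> L then [Hit] else []"]) (auto simp: advice_bound_def)
  next
    case False
    then have m: "m \<ge> 1"
      by simp
    define C where "C = L \<inter> {x. length x = m}"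
    have finC: "finite C"
      unfolding C_def using length_strings_finite(1)[of m] by blast
    have cardC: "card C \<le> 2 ^ m"
      unfolding length_strings_finite(2)[of m, symmetric] C_def
      by (intro card_mono length_strings_finite) blast
    define t where "t = poly p (m * (2 * m + 1))"
    \<comment> \<open>Fairness is used with \<open>n = m\<close>; \<open>t\<close> is the time bound
      at the length of an encoded tuple of \<open>m\<close> strings of length
      \<open>m\<close>.\<close>
    have key: "\<exists>zs. f (encode_tuple ys) = encode_tuple zs \<and> zs \<noteq> [] \<and> set zs \<subseteq> set ys \<and> set zs \<subseteq> L \<and>
        computes_within M (encode_tuple ys) (encode_tuple zs) t"
      if ys: "sorted_wrt lex_less ys" "length ys = m" "\<forall>y \<in> set ys. length y = m" "card (L \<inter> set ys) \<ge> m - 1" for ys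
    proof -
      obtain zs where zs: "f (encode_tuple ys) = encode_tuple zs" "set zs \<subseteq> set ys" "set zs \<subseteq> L" "card (set zs) \<ge> 1"
        using F[rule_format, OF m, of ys] sorted_distinct[OF ys(1)] ys by auto
      have "computes_within M (encode_tuple ys) (encode_tuple zs) t"
        using M(2)[of "encode_tuple ys"] length_encode_tuple[OF ys(3)] ys(2) zs(1) by (simp add: t_def)
      then show ?thesis
        using zs by auto
    qed
    define srt where "srt T = (SOME ys. set ys = T \<and> sorted_wrt lex_less ys)" for T
    have srt: "set (srt T) = T" "sorted_wrt lex_less (srt T)" if "finite T" for T
      using someI_ex[OF sorted_list_ex[OF that]] by (auto simp: srt_def)
    \<comment> \<open>As \<open>encode_tuple\<close> is injective, the choice is determined whenever
      the output encodes a tuple.\<close>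
    define sel where "sel T = set (SOME zs. f (encode_tuple (srt T)) = encode_tuple zs)" for T
    have sel_eq: "sel (set ys) = set zs" if "sorted_wrt lex_less ys" "f (encode_tuple ys) = encode_tuple zs" for ys zs
    proof -
      have "srt (set ys) = ys"
        using srt[of "set ys"] that(1) by (intro sorted_unique) auto
      then show ?thesis
        using that(2) by (simp add: sel_def encode_tuple_inject)
    qed
    have sel: "sel T \<noteq> {} \<and> sel T \<subseteq> T" if T: "T \<subseteq> C" "card T = m" for T
    proof -
      have fT: "finite T"
        using T(1) finC by (rule finite_subset)
      note s = srt[OF fT]
      have "length (srt T) = m"
        using distinct_card[OF sorted_distinct[OF s(2)]] s(1) T(2) by simp
      moreover have "L \<inter> set (srt T) = T"
        using T(1) s(1) by (auto simp: C_def)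
      moreover have "\<forall>y \<in> set (srt T). length y = m"
        using T(1) s(1) by (auto simp: C_def)
      ultimately obtain zs where "f (encode_tuple (srt T)) = encode_tuple zs" "zs \<noteq> []" "set zs \<subseteq> T"
        using key[OF s(2)] T(2) s(1) by auto
      then show ?thesis
        using sel_eq[OF s(2)] s(1) by auto
    qed
    define r where "r = m * (m + 1)"
    obtain Ss D where cover: "length Ss \<le> r" "D \<subseteq> C" "card D \<le> m * r"
        "\<forall>S \<in> set Ss. S \<subseteq> C \<and> card S = m - 1"
        "\<forall>x \<in> C. x \<in> D \<or> (\<exists>S \<in> set Ss. x \<notin> S \<and> x \<in> sel (insert x S))"
      using winners_cover[where sel = sel, OF m finC sel rounds_suffice[OF m cardC]] unfolding r_def
      by blast
    obtain ds where ds: "set ds = D" "distinct ds"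
      using finite_distinct_list[of D] finC cover(2) by (auto dest: finite_subset)
    \<comment> \<open>\<open>x\<close> may belong into any of the \<open>m\<close> gaps of the
      sorted tuple of \<open>S\<close>, which has m-1 entries.\<close>
    define ps where "ps = concat (map (\<lambda>S. map (\<lambda>j. (take j (srt S), drop j (srt S))) [0..<m]) Ss)"
    have S: "set (srt S) = S" "sorted_wrt lex_less (srt S)" "length (srt S) = m - 1" "\<forall>y \<in> S. y \<in> L \<and> length y = m"
      "finite S" if "S \<in> set Ss" for S
    proof -
      have s: "S \<subseteq> C" "card S = m - 1"
        using cover(4) that by auto
      then show fS: "finite S"
        using finC finite_subset by blast
      show "set (srt S) = S" "sorted_wrt lex_less (srt S)"
        by (rule srt[OF fS])+
      then show "length (srt S) = m - 1"
        using distinct_card[OF sorted_distinct[of "srt S"]] s(2) by simp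
      show "\<forall>y \<in> S. y \<in> L \<and> length y = m"
        using s(1) by (auto simp: C_def)
    qed
    have psE: "\<exists>S \<in> set Ss. srt S = ys1 @ ys2" if "(ys1, ys2) \<in> set ps" for ys1 ys2
      using that by (auto simp: ps_def)
    have psI: "(ys1, ys2) \<in> set ps" if "S \<in> set Ss" "srt S = ys1 @ ys2" for S ys1 ys2
    proof -
      have "length ys1 < m"
        using S(3)[OF that(1)] that(2) m by simp
      then show ?thesis
        using that unfolding ps_def by (force intro!: bexI[of _ S] image_eqI[of _ _ "length ys1"])
    qed
    have ps_len: "\<forall>y \<in> set (ys1 @ ys2). length y = m" "length (ys1 @ ys2) = m - 1" if p: "(ys1, ys2) \<in> set ps" for ys1 ys2
      using psE[OF p] S by metis+
    define prog where "prog = replicate m XLeft @ concat (map (check Hit) ds) @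
        concat (map (\<lambda>(ys1, ys2). query m t ys1 ys2) ps)"
    have "length (concat (map (check Hit) ds)) \<le> length ds * (2 * m + 1)"
      using ds(1) cover(2) by (intro length_concat_le) (auto simp: check_def C_def)
    also have "\<dots> \<le> m * r * (2 * m + 1)"
      using cover(3) distinct_card[OF ds(2)] ds(1) by (intro mult_right_mono) auto
    finally have l1: "length (concat (map (check Hit) ds)) \<le> m * r * (2 * m + 1)" .
    have "length ps = length Ss * m"
      unfolding ps_def by (induction Ss) auto
    then have "length ps \<le> r * m"
      using cover(1) by simp
    moreover have "length (concat (map (\<lambda>(ys1, ys2). query m t ys1 ys2) ps)) \<le> length ps * query_bound m t"
      using length_query[OF ps_len m] by (intro length_concat_le) auto
    ultimately have l2: "length (concat (map (\<lambda>(ys1, ys2). query m t ys1 ys2) ps)) \<le> r * m * query_bound m t"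
      by (meson le_trans mult_le_mono1)
    have len: "length prog \<le> advice_bound p m"
      using l1 l2 unfolding prog_def advice_bound_def r_def t_def by simp
    have "x \<in> L \<longleftrightarrow> hd (fold ?E prog (init_tapes (num_tapes M + 5) x)) 0 = 2" if x: "length x = m" for x
    proof -
      let ?g = "\<lambda>ys1 ys2. (\<forall>y \<in> set ys1. lex_less y x) \<and> (\<forall>y \<in> set ys2. lex_less x y)"
      let ?q = "\<exists>(ys1, ys2) \<in> set ps. (\<forall>y \<in> set ys1. lex_less y x) \<and> (\<forall>y \<in> set ys2. lex_less x y) \<and>
             query_hit M t (encode_tuple (ys1 @ x # ys2)) x"
      have lds: "\<forall>y \<in> set ds. length y = length x"
        using ds(1) cover(2) x by (auto simp: C_def)
      have lps: "\<forall>(ys1, ys2) \<in> set ps. \<forall>y \<in> set (ys1 @ ys2). length y = length x"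
        using ps_len(1) x by fastforce
      have start: "fold ?E (replicate m XLeft) (init_tapes (num_tapes M + 5) x) = home M 0 x"
        by (simp add: init_tapes_St fold_XLeft x)
      have "fold ?E prog (init_tapes (num_tapes M + 5) x) = home M (if ?q then 2 else if x \<in> D then 2 else 0) x"
        unfolding prog_def fold_append comp_def start fold_checks_hit[OF lds] ds(1)
          fold_queries[OF M(1) lps, of t, unfolded x] ..
      then have acc: "hd (fold ?E prog (init_tapes (num_tapes M + 5) x)) 0 = 2 \<longleftrightarrow> ?q \<or> x \<in> D"
        by simp
      \<comment> \<open>\<open>x\<close> is not assumed to be in \<open>L\<close>: the m-1 strings
        from \<open>S'\<close> alone satisfy the premise of fairness, so being selected proves
        membership.\<close>
      have hit: "query_hit M t (encode_tuple (ys1 @ x # ys2)) x \<longleftrightarrow> x \<in> sel (insert x (set (ys1 @ ys2)))"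
          "sel (insert x (set (ys1 @ ys2))) \<subseteq> L"
        if p: "(ys1, ys2) \<in> set ps" and s: "sorted_wrt lex_less (ys1 @ x # ys2)" for ys1 ys2
      proof -
        obtain S' where S': "S' \<in> set Ss" "srt S' = ys1 @ ys2"
          using psE[OF p] by blast
        note S'' = S[OF S'(1), unfolded S'(2)]
        have "set (ys1 @ ys2) \<subseteq> L \<inter> set (ys1 @ x # ys2)"
          using S''(1,4) by auto
        then have "card (set (ys1 @ ys2)) \<le> card (L \<inter> set (ys1 @ x # ys2))"
          by (intro card_mono) auto
        then have "m - 1 \<le> card (L \<inter> set (ys1 @ x # ys2))"
          using distinct_card[OF sorted_distinct[OF S''(2)]] S''(3) by simp
        then obtain zs where zs: "f (encode_tuple (ys1 @ x # ys2)) = encode_tuple zs" "zs \<noteq> []"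
            "set zs \<subseteq> set (ys1 @ x # ys2)" "set zs \<subseteq> L"
            "computes_within M (encode_tuple (ys1 @ x # ys2)) (encode_tuple zs) t"
          using key[OF s] ps_len[OF p] x m by auto
        have "sel (insert x (set (ys1 @ ys2))) = set zs"
          using sel_eq[OF s zs(1)] by simp
        moreover have "\<forall>z \<in> set zs. length z = length x"
          using zs(3) ps_len(1)[OF p] x by auto
        moreover have "x \<noteq> []"
          using x m by auto
        ultimately show "query_hit M t (encode_tuple (ys1 @ x # ys2)) x \<longleftrightarrow> x \<in> sel (insert x (set (ys1 @ ys2)))"
            "sel (insert x (set (ys1 @ ys2))) \<subseteq> L"
          using query_hit_iff[OF M(1) zs(5,2)] zs(4) by auto
      qed
      show ?thesis
        unfolding acc
      proof
        assume xL: "x \<in> L"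
        show "?q \<or> x \<in> D"
        proof (cases "x \<in> D")
          case False
          then obtain S' where S': "S' \<in> set Ss" "x \<notin> S'" "x \<in> sel (insert x S')"
            using cover(5) xL x by (auto simp: C_def)
          note S'' = S[OF S'(1)]
          obtain ys1 ys2 where ys: "srt S' = ys1 @ ys2" "sorted_wrt lex_less (ys1 @ x # ys2)"
            using sorted_insert_ex[OF S''(2), of x] S''(1) S'(2) by auto
          have p: "(ys1, ys2) \<in> set ps"
            by (rule psI[OF S'(1) ys(1)])
          have "query_hit M t (encode_tuple (ys1 @ x # ys2)) x"
            using hit(1)[OF p ys(2)] S'(3) S''(1) ys(1) by simp
          moreover have "?g ys1 ys2"
            using ys(2) by (auto simp: sorted_wrt_append)
          ultimately show ?thesis
            using p by blast
        qed simp
      next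
        assume "?q \<or> x \<in> D"
        then show "x \<in> L"
        proof
          assume ?q
          then obtain ys1 ys2 where q: "(ys1, ys2) \<in> set ps" "?g ys1 ys2"
              "query_hit M t (encode_tuple (ys1 @ x # ys2)) x"
            by blast
          obtain S' where "S' \<in> set Ss" "srt S' = ys1 @ ys2"
            using psE[OF q(1)] by blast
          then have "sorted_wrt lex_less (ys1 @ ys2)"
            using S(2) by metis
          \<comment> \<open>The satisfied guard makes the queried tuple sorted, so the answer can be
            trusted by \<open>hit\<close>.\<close>
          then have "sorted_wrt lex_less (ys1 @ x # ys2)"
            using q(2) by (auto simp: sorted_wrt_append)
          then show "x \<in> L"
            using hit[OF q(1)] q(3) by blast
        next
          assume "x \<in> D"
          then show "x \<in> L"
            using cover(2) by (auto simp: C_def)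
        qed
      qed
    qed
    then show ?thesis
      using len by blast
  qed
  then show ?thesis
    using M(1) by blast
qed

theorem theorem3p14: "Fair_S (\<lambda>n. n - 1) (\<lambda>n. 1) \<subseteq> P_poly"
proof
  fix L
  assume "L \<in> Fair_S (\<lambda>n. n - 1) (\<lambda>n. 1)"
  from advice_program_ex[OF this] obtain M p where M: "wf_tm M" and ex: "\<And>m. \<exists>is. length is \<le> advice_bound p m \<and>
      (\<forall>x. length x = m \<longrightarrow>
         (x \<in> L \<longleftrightarrow> hd (fold (exec (delta M)) is (init_tapes (num_tapes M + 5) x)) 0 = 2))"
    by blast
  obtain prog where prog: "\<And>m. length (prog m) \<le> advice_bound p m"
      "\<And>x. x \<in> L \<longleftrightarrow> hd (fold (exec (delta M)) (prog (length x)) (init_tapes (num_tapes M + 5) x)) 0 = 2"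
    using ex by metis
  define k where "k = card (UNIV :: instr set)"
  \<comment> \<open>One alphabet serves the parsing register, the symbols of \<open>M\<close> and
    its states, which are stored as symbols.\<close>
  let ?N = "2 * k + 4 + num_symbols M + num_states M"
  have "wf_instr (num_tapes M + 5) ?N (delta M i)" for i
    by (rule wf_delta[OF M]) auto
  then obtain A and code :: "instr \<Rightarrow> str" where A: "A \<in> P" "\<And>i. length (code i) \<le> k"
    "\<And>x is. encode_pair x (concat (map code is)) \<in> A \<longleftrightarrow>
       hd (fold (exec (delta M)) is (init_tapes (num_tapes M + 5) x)) 0 = 2"
    using program_decider[of "num_tapes M + 5" ?N "delta M"] unfolding k_def by auto
  define h where "h z = concat (map code (prog (length z)))" for z :: str
  have "polyf (\<lambda>m. advice_bound p m * k)"
    by (intro polyf_intros polyf_advice_bound)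
  then obtain q :: "nat poly" where q: "\<And>m. advice_bound p m * k = poly q m"
    unfolding polyf_def by blast
  have "length (h z) \<le> poly q (length z)" for z
  proof -
    have "length (h z) \<le> length (prog (length z)) * k"
      unfolding h_def using A(2) by (intro length_concat_le) blast
    also have "\<dots> \<le> advice_bound p (length z) * k"
      by (intro mult_right_mono prog(1)) simp
    finally show ?thesis
      by (simp add: q)
  qed
  then have "poly_length_bounded h"
    unfolding poly_length_bounded_def by blast
  moreover have "x \<in> L \<longleftrightarrow> encode_pair x (h (replicate (length x) False)) \<in> A" for x
    unfolding prog(2)[of x] h_def length_replicate A(3) ..
  ultimately show "L \<in> P_poly"
    unfolding P_poly_def using A(1) by blast
qed

end
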